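(* Consider the problem of minimizing $\varphi(x):=\frac12\langle Ax,x\rangle+\langle b,x\rangle+\alpha+g(x)$ over $x\in\mathbb{R}^n$, where $A\in\mathbb{R}^{n\times n}$ is symmetric positive-definite, $b\in\mathbb{R}^n$, $\alpha\in\mathbb{R}$, and $g:\mathbb{R}^n\to(-\infty,\infty]$ is proper, lower semicontinuous and convex. Then: (i) the Generalized Damped Newton Algorithm for Quadratic Composite Optimization is well-defined, and its sequence of iterates $\{u^k\}$ globally converges at least R-linearly to some $\bar u$; (ii) $\bar x:=Q\bar u+c$ is a tilt-stable local minimizer of $\varphi$ and is the unique solution of the problem. Furthermore, the convergence of $\{u^k\}$ is at least Q-superlinear if the subgradient mapping $\partial g$ is semismooth$^*$ at $(\bar x,\bar v)$ with $\bar v:=-A\bar x-b$, and one of the following holds: (a) $\sigma\in(0,1/(2\ell\kappa))$ where $\ell:=1+\|Q\|$ and $\kappa:=1/\lambda_{\min}(P)$; (b) $g$ is twice epi-differentiable at $\bar x$ for $\bar v$.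
   Context: Moreau envelope and proximal map of $g$ with $\gamma>0$: $e_\gamma g(x):=\inf_y\{g(y)+\frac1{2\gamma}\|y-x\|^2\}$, $\operatorname{Prox}_{\gamma g}(x):=\operatorname{argmin}_y\{g(y)+\frac1{2\gamma}\|y-x\|^2\}$. Generalized Damped Newton Algorithm for Quadratic Composite Optimization: input $A,b,g$, $\sigma\in(0,\tfrac12)$, $\beta\in(0,1)$. Choose $\gamma>0$ with $I-\gamma A$ positive-definite; set $Q:=(I-\gamma A)^{-1}$, $c:=\gamma Qb$, $P:=Q-I$, and $\psi(u):=\frac12\langle Pu,u\rangle+\langle c,u\rangle+\gamma e_\gamma g(u)$ (so $\nabla\psi(u)=Qu-\operatorname{Prox}_{\gamma g}(u)+c$). Choose $u^0$, $k=0$. If $\nabla\psi(u^k)=0$ stop; else set $v^k:=\operatorname{Prox}_{\gamma g}(u^k)$ and find $d^k$ with $\frac1\gamma(-\nabla\psi(u^k)-Pd^k)\in\partial^2 g\big(v^k,\frac1\gamma(u^k-v^k)\big)(Qd^k+\nabla\psi(u^k))$; set $\tau_k=1$ and while $\psi(u^k+\tau_kd^k)>\psi(u^k)+\sigma\tau_k\langle\nabla\psi(u^k),d^k\rangle$ replace $\tau_k$ by $\beta\tau_k$; set $u^{k+1}:=u^k+\tau_kd^k$, increase $k$, repeat. Output $x^k:=Qu^k+c$. Here $\partial g$ is the convex subdifferential; for $(x,y)\in\operatorname{gph}\partial g$, $\partial^2g(x,y)(w):=\{z\mid (z,-w)\in N_{\operatorname{gph}\partial g}(x,y)\}$, where $N$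 is the limiting normal cone: $N_\Omega(\bar z)$ consists of $v$ with $z_k\to\bar z$, $z_k\in\Omega$, $v_k\to v$, $v_k\in\widehat N_\Omega(z_k)$, and $\widehat N_\Omega(\bar z):=\{v\mid \limsup_{z\to\bar z,z\in\Omega}\langle v,z-\bar z\rangle/\|z-\bar z\|\le0\}$. Semismooth$^*$: with $N_\Omega(\bar z;d):=\{v\mid\exists t_k\downarrow0,d_k\to d,v_k\to v,\ v_k\in\widehat N_\Omega(\bar z+t_kd_k)\}$ and $D^*F((\bar x,\bar y);(u,v))(v^* ):=\{u^*\mid(u^*,-v^* )\in N_{\operatorname{gph}F}((\bar x,\bar y);(u,v))\}$, $F$ is semismooth$^*$ at $(\bar x,\bar y)$ if for all $(u,v)$, $\langle u^*,u\rangle=\langle v^*,v\rangle$ whenever $u^*\in D^*F((\bar x,\bar y);(u,v))(v^* )$. Twice epi-differentiability: $g$ is twice epi-differentiable at $\bar x$ for $v$ if for every $w$ and every $\tau_k\downarrow0$ there is $w^k\to w$ with $\frac{g(\bar x+\tau_kw^k)-g(\bar x)-\tau_k\langle v,w^k\rangle}{\tau_k^2/2}\to d^2g(\bar x,v)(w)$, where $d^2g(\bar x,v)(w):=\liminf_{\tau\downarrow0,u\to w}\frac{g(\bar x+\tau u)-g(\bar x)-\tau\langle v,u\rangle}{\tau^2/2}$. Tilt stability: $\bar x$ is a tilt-stable local minimizer of $\varphi$ if for some $\gamma'>0$ the map $v\mapsto\operatorname{argmin}\{\varphi(x)-\langle v,x\rangle\mid x\in\mathbb{B}_{\gamma'}(\bar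 x)\}$ is single-valued and Lipschitz near $0$ with value $\{\bar x\}$ at $0$. R-linear convergence: $\|u^k-\bar u\|\le C\mu^k$ for some $C>0$, $\mu\in(0,1)$ and all large $k$; Q-superlinear: $\|u^{k+1}-\bar u\|/\|u^k-\bar u\|\to0$. *)

theory Defs
  imports "HOL-Analysis.Analysis"
begin

definition proper_fun :: "('a \<Rightarrow> ereal) \<Rightarrow> bool" where
  "proper_fun g \<longleftrightarrow> (\<forall>x. g x \<noteq> -\<infinity>) \<and> (\<exists>x. g x \<noteq> \<infinity>)"

definition lsc_fun :: "('a::topological_space \<Rightarrow> ereal) \<Rightarrow> bool" where
  "lsc_fun g \<longleftrightarrow> (\<forall>x. g x \<le> Liminf (at x) g)"

definition convex_fun :: "('a::real_vector \<Rightarrow> ereal) \<Rightarrow> bool" where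
  "convex_fun g \<longleftrightarrow> (\<forall>x y t. 0 < t \<and> t < 1 \<longrightarrow>
      g ((1 - t) *\<^sub>R x + t *\<^sub>R y) \<le> ereal (1 - t) * g x + ereal t * g y)"

definition subdiff :: "('a::real_inner \<Rightarrow> ereal) \<Rightarrow> 'a \<Rightarrow> 'a set" where
  "subdiff g x = {y. \<bar>g x\<bar> \<noteq> \<infinity> \<and> (\<forall>z. g z \<ge> g x + ereal (inner y (z - x)))}"

definition gph :: "('a \<Rightarrow> 'b set) \<Rightarrow> ('a \<times> 'b) set" where
  "gph F = {(x, y). y \<in> F x}"

definition moreau_env :: "real \<Rightarrow> ('a::real_normed_vector \<Rightarrow> ereal) \<Rightarrow> 'a \<Rightarrow> ereal" where
  "moreau_env \<gamma> g x = (INF y. g y + ereal ((norm (y - x))\<^sup>2 / (2 * \<gamma>)))"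

definition prox_set :: "real \<Rightarrow> ('a::real_normed_vector \<Rightarrow> ereal) \<Rightarrow> 'a \<Rightarrow> 'a set" where
  "prox_set \<gamma> g x = {y. \<forall>z. g y + ereal ((norm (y - x))\<^sup>2 / (2 * \<gamma>))
                          \<le> g z + ereal ((norm (z - x))\<^sup>2 / (2 * \<gamma>))}"

text \<open>The proximal point (the prox set is a singleton under the standing assumptions).\<close>
definition prox :: "real \<Rightarrow> ('a::real_normed_vector \<Rightarrow> ereal) \<Rightarrow> 'a \<Rightarrow> 'a" where
  "prox \<gamma> g x = (SOME y. y \<in> prox_set \<gamma> g x)"

text \<open>Regular normal cone: limsup_{z\<rightarrow>zb, z\<in>\<Omega>} <v,z-zb>/|z-zb| \<le> 0, written out.\<close>
definition reg_normal :: "'a::real_inner set \<Rightarrow> 'a \<Rightarrow> 'a set" where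
  "reg_normal \<Omega> zb = {v. zb \<in> \<Omega> \<and> (\<forall>\<epsilon>>0. \<exists>\<delta>>0. \<forall>z\<in>\<Omega>.
        norm (z - zb) < \<delta> \<longrightarrow> inner v (z - zb) \<le> \<epsilon> * norm (z - zb))}"

definition lim_normal :: "'a::real_inner set \<Rightarrow> 'a \<Rightarrow> 'a set" where
  "lim_normal \<Omega> zb = {v. \<exists>z w. (\<forall>k. z k \<in> \<Omega> \<and> w k \<in> reg_normal \<Omega> (z k))
        \<and> z \<longlonglongrightarrow> zb \<and> w \<longlonglongrightarrow> v}"

definition dir_normal :: "'a::real_inner set \<Rightarrow> 'a \<Rightarrow> 'a \<Rightarrow> 'a set" where
  "dir_normal \<Omega> zb d = {v. \<exists>t dd w. (\<forall>k. t k > 0 \<and> w k \<in> reg_normal \<Omega> (zb + t k *\<^sub>R dd k))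
        \<and> t \<longlonglongrightarrow> 0 \<and> dd \<longlonglongrightarrow> d \<and> w \<longlonglongrightarrow> v}"

definition subdiff2 :: "('a::real_inner \<Rightarrow> ereal) \<Rightarrow> 'a \<Rightarrow> 'a \<Rightarrow> 'a \<Rightarrow> 'a set" where
  "subdiff2 g x y w = {z. (z, - w) \<in> lim_normal (gph (subdiff g)) (x, y)}"

definition dir_coderiv ::
  "('a::real_inner \<Rightarrow> 'b::real_inner set) \<Rightarrow> 'a \<times> 'b \<Rightarrow> 'a \<times> 'b \<Rightarrow> 'b \<Rightarrow> 'a set" where
  "dir_coderiv F p d vs = {us. (us, - vs) \<in> dir_normal (gph F) p d}"

definition semismooth_star :: "('a::real_inner \<Rightarrow> 'b::real_inner set) \<Rightarrow> 'a \<times> 'b \<Rightarrow> bool" where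
  "semismooth_star F p \<longleftrightarrow> (\<forall>u v us vs. us \<in> dir_coderiv F p (u, v) vs \<longrightarrow> inner us u = inner vs v)"

definition second_subderiv :: "('a::real_inner \<Rightarrow> ereal) \<Rightarrow> 'a \<Rightarrow> 'a \<Rightarrow> 'a \<Rightarrow> ereal" where
  "second_subderiv g xb v w = Liminf (at_right 0 \<times>\<^sub>F nhds w)
      (\<lambda>(\<tau>, u). (g (xb + \<tau> *\<^sub>R u) - g xb - ereal (\<tau> * inner v u)) / ereal (\<tau>\<^sup>2 / 2))"

definition twice_epi_diff :: "('a::real_inner \<Rightarrow> ereal) \<Rightarrow> 'a \<Rightarrow> 'a \<Rightarrow> bool" where
  "twice_epi_diff g xb v \<longleftrightarrow> (\<forall>w \<tau>. (\<forall>k. \<tau> k > 0) \<and> \<tau> \<longlonglongrightarrow> 0 \<longrightarrow>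
      (\<exists>ws. ws \<longlonglongrightarrow> w \<and>
        ((\<lambda>k. (g (xb + \<tau> k *\<^sub>R ws k) - g xb - ereal (\<tau> k * inner v (ws k))) / ereal ((\<tau> k)\<^sup>2 / 2))
           \<longlonglongrightarrow> second_subderiv g xb v w)))"

definition tilt_stable_min :: "('a::real_inner \<Rightarrow> ereal) \<Rightarrow> 'a \<Rightarrow> bool" where
  "tilt_stable_min \<phi> xb \<longleftrightarrow> (\<exists>\<gamma>'>0. \<exists>\<delta>>0. \<exists>L M. M 0 = xb \<and> L-lipschitz_on (ball 0 \<delta>) M \<and>
     (\<forall>v\<in>ball 0 \<delta>. {x \<in> cball xb \<gamma>'. \<forall>y\<in>cball xb \<gamma>'.
          \<phi> x - ereal (inner v x) \<le> \<phi> y - ereal (inner v y)} = {M v}))"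

definition R_linear_conv :: "(nat \<Rightarrow> 'a::real_normed_vector) \<Rightarrow> 'a \<Rightarrow> bool" where
  "R_linear_conv u ub \<longleftrightarrow> (\<exists>C>0. \<exists>\<mu>. 0 < \<mu> \<and> \<mu> < 1 \<and>
      (\<forall>\<^sub>F k in sequentially. norm (u k - ub) \<le> C * \<mu> ^ k))"

definition Q_superlinear_conv :: "(nat \<Rightarrow> 'a::real_normed_vector) \<Rightarrow> 'a \<Rightarrow> bool" where
  "Q_superlinear_conv u ub \<longleftrightarrow> (\<lambda>k. norm (u (Suc k) - ub) / norm (u k - ub)) \<longlonglongrightarrow> 0"

definition sym_mat :: "real^'n^'n \<Rightarrow> bool" where
  "sym_mat A \<longleftrightarrow> transpose A = A"

definition pos_def :: "real^'n^'n \<Rightarrow> bool" where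
  "pos_def A \<longleftrightarrow> (\<forall>x. x \<noteq> 0 \<longrightarrow> 0 < inner x (A *v x))"

definition lambda_min :: "real^'n^'n \<Rightarrow> real" where
  "lambda_min P = Inf {lam. \<exists>x. x \<noteq> 0 \<and> P *v x = lam *\<^sub>R x}"

definition mat_norm :: "real^'n^'n \<Rightarrow> real" where
  "mat_norm Q = onorm (\<lambda>x. Q *v x)"

definition gdna_Q :: "real^'n^'n \<Rightarrow> real \<Rightarrow> real^'n^'n" where
  "gdna_Q A \<gamma> = matrix_inv (mat 1 - \<gamma> *\<^sub>R A)"

definition gdna_c :: "real^'n^'n \<Rightarrow> real^'n \<Rightarrow> real \<Rightarrow> real^'n" where
  "gdna_c A b \<gamma> = \<gamma> *\<^sub>R (gdna_Q A \<gamma> *v b)"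

definition gdna_P :: "real^'n^'n \<Rightarrow> real \<Rightarrow> real^'n^'n" where
  "gdna_P A \<gamma> = gdna_Q A \<gamma> - mat 1"

definition gdna_psi :: "real^'n^'n \<Rightarrow> real^'n \<Rightarrow> (real^'n \<Rightarrow> ereal) \<Rightarrow> real \<Rightarrow> real^'n \<Rightarrow> real" where
  "gdna_psi A b g \<gamma> u = 1/2 * inner (gdna_P A \<gamma> *v u) u + inner (gdna_c A b \<gamma>) u
      + \<gamma> * real_of_ereal (moreau_env \<gamma> g u)"

definition gdna_grad :: "real^'n^'n \<Rightarrow> real^'n \<Rightarrow> (real^'n \<Rightarrow> ereal) \<Rightarrow> real \<Rightarrow> real^'n \<Rightarrow> real^'n" where
  "gdna_grad A b g \<gamma> u = gdna_Q A \<gamma> *v u - prox \<gamma> g u + gdna_c A b \<gamma>"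

definition gdna_dir_ok :: "real^'n^'n \<Rightarrow> real^'n \<Rightarrow> (real^'n \<Rightarrow> ereal) \<Rightarrow> real \<Rightarrow> real^'n \<Rightarrow> real^'n \<Rightarrow> bool" where
  "gdna_dir_ok A b g \<gamma> u d \<longleftrightarrow>
     (let v = prox \<gamma> g u; G = gdna_grad A b g \<gamma> u in
       (1/\<gamma>) *\<^sub>R (- G - gdna_P A \<gamma> *v d)
          \<in> subdiff2 g v ((1/\<gamma>) *\<^sub>R (u - v)) (gdna_Q A \<gamma> *v d + G))"

definition armijo :: "real^'n^'n \<Rightarrow> real^'n \<Rightarrow> (real^'n \<Rightarrow> ereal) \<Rightarrow> real \<Rightarrow> real \<Rightarrow> real^'n \<Rightarrow> real^'n \<Rightarrow> real \<Rightarrow> bool" where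
  "armijo A b g \<gamma> \<sigma> u d \<tau> \<longleftrightarrow>
     gdna_psi A b g \<gamma> (u + \<tau> *\<^sub>R d) \<le> gdna_psi A b g \<gamma> u + \<sigma> * \<tau> * inner (gdna_grad A b g \<gamma> u) d"

text \<open>One step u \<mapsto> u' of the algorithm.  Once the stopping test holds the sequence is
  continued constantly.  The backtracking loop yields \<tau> = \<beta>^j with j the least index
  satisfying the Armijo condition.\<close>
definition gdna_step :: "real^'n^'n \<Rightarrow> real^'n \<Rightarrow> (real^'n \<Rightarrow> ereal) \<Rightarrow> real \<Rightarrow> real \<Rightarrow> real
     \<Rightarrow> real^'n \<Rightarrow> real^'n \<Rightarrow> bool" where
  "gdna_step A b g \<gamma> \<sigma> \<beta> u u' \<longleftrightarrow>
     (if gdna_grad A b g \<gamma> u = 0 then u' = u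
      else (\<exists>d. gdna_dir_ok A b g \<gamma> u d \<and>
              u' = u + (\<beta> ^ (LEAST j. armijo A b g \<gamma> \<sigma> u d (\<beta> ^ j))) *\<^sub>R d))"

definition gdna_well_defined :: "real^'n^'n \<Rightarrow> real^'n \<Rightarrow> (real^'n \<Rightarrow> ereal) \<Rightarrow> real \<Rightarrow> real \<Rightarrow> real \<Rightarrow> bool" where
  "gdna_well_defined A b g \<gamma> \<sigma> \<beta> \<longleftrightarrow>
     (\<forall>u0. \<exists>u. u 0 = u0 \<and> (\<forall>k. gdna_step A b g \<gamma> \<sigma> \<beta> (u k) (u (Suc k)))) \<and>
     (\<forall>u. (\<forall>k. gdna_step A b g \<gamma> \<sigma> \<beta> (u k) (u (Suc k))) \<longrightarrow>
        (\<forall>k. gdna_grad A b g \<gamma> (u k) \<noteq> 0 \<longrightarrow>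
          (\<exists>d. gdna_dir_ok A b g \<gamma> (u k) d) \<and>
          (\<forall>d. gdna_dir_ok A b g \<gamma> (u k) d \<longrightarrow> (\<exists>j::nat. armijo A b g \<gamma> \<sigma> (u k) d (\<beta> ^ j)))))"

end

theory Submission
  imports Defs
begin

text \<open>
  The proximal map \<open>T\<close> parametrizes \<open>gph \<partial>g\<close> by \<open>u \<mapsto> (T u, (u - T u) / \<gamma>)\<close>, so normals to that graph
  are coderivative values of the gradient \<open>F u = Q u - T u + c\<close> of \<open>\<psi>\<close>, and the Newton inclusion
  becomes \<open>- F u \<in> D\<^sup>*F(u)(d)\<close>. As \<open>\<psi>\<close> is strongly convex with Lipschitz gradient, such \<open>d\<close> exist, are
  descent directions of length comparable to \<open>|F u|\<close>, and the backtracking steps are bounded below,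
  whence linear convergence of the values of \<open>\<psi>\<close> to the minimum.

  For superlinear convergence one usually invokes the symmetry of generalized Hessians and
  Rademacher's theorem. Here semismoothness at the zero \<open>ub\<close> of \<open>F\<close> makes \<open>F (ub + t w) / t\<close> nearly
  independent of \<open>t\<close>. Differentiating \<open>\<psi> (ub + t w) / t\<^sup>2\<close> in \<open>t\<close> then shows that
  \<open>p u = \<langle>F u, u - ub\<rangle> - 2 \<psi> u\<close> is Lipschitz near \<open>ub\<close> with a constant of order \<open>o(|u - ub|)\<close>. Adding this to the
  inequality defining a regular coderivative value and testing along \<open>u + d - ub\<close> gives
  \<open>|u + d - ub| = o(|u - ub|)\<close>; and \<open>\<psi> u - \<psi> ub = \<langle>F u, u - ub\<rangle> / 2 + o(|u - ub|\<^sup>2)\<close> shows that unit steps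
  near \<open>ub\<close> pass the Armijo test, as \<open>\<sigma> < 1/2\<close>.
\<close>

section \<open>Coderivatives and Newton steps for strongly convex functions\<close>

text \<open>\<open>z\<close> is a regular subgradient at \<open>u\<close> of the scalar function
  pairing \<open>F\<close> with \<open>d\<close>. For Lipschitz \<open>F\<close> this says that
  (\<open>z\<close>, \<open>- d\<close>) is a regular normal to the graph of \<open>F\<close> at
  (\<open>u\<close>, \<open>F u\<close>).\<close>

definition reg_coderiv :: "('a::real_inner \<Rightarrow> 'b::real_inner) \<Rightarrow> 'a \<Rightarrow> 'b \<Rightarrow> 'a set" where
  "reg_coderiv F u d = {z. \<forall>\<epsilon>>0. \<exists>\<delta>>0. \<forall>u'. norm (u' - u) < \<delta> \<longrightarrow>
     inner z (u' - u) - inner d (F u' - F u) \<le> \<epsilon> * norm (u' - u)}"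

definition lim_coderiv :: "('a::real_inner \<Rightarrow> 'b::real_inner) \<Rightarrow> 'a \<Rightarrow> 'b \<Rightarrow> 'a set" where
  "lim_coderiv F u d = {z. \<exists>us ds zs. (\<forall>k. zs k \<in> reg_coderiv F (us k) (ds k)) \<and>
     us \<longlonglongrightarrow> u \<and> ds \<longlonglongrightarrow> d \<and> zs \<longlonglongrightarrow> z}"

text \<open>Directional limits are replaced by one estimate, uniform over nearby base points and
  homogeneous in \<open>d\<close>; \<open>semismooth_star_imp_semismooth_at\<close> supplies it for
  the gradient of psi.\<close>

definition semismooth_at :: "('a::real_inner \<Rightarrow> 'b::real_inner) \<Rightarrow> 'a \<Rightarrow> bool" where
  "semismooth_at F ub \<longleftrightarrow> (\<forall>\<epsilon>>0. \<exists>\<delta>>0. \<forall>u d z. norm (u - ub) < \<delta> \<longrightarrow> z \<in> reg_coderiv F u d \<longrightarrow>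
     \<bar>inner z (u - ub) - inner d (F u - F ub)\<bar> \<le> \<epsilon> * norm (u - ub) * norm d)"

lemma norm_diff_square_expand:
  fixes a c x :: "'a::real_inner"
  shows "(norm (x - c))\<^sup>2 = (norm (a - c))\<^sup>2 + 2 * inner (a - c) (x - a) + (norm (x - a))\<^sup>2"
  by (simp add: power2_norm_eq_inner inner_diff_left inner_diff_right inner_commute)

lemma penalized_ray_derivative:
  fixes y w :: "'a::real_inner"
  assumes "s \<noteq> 0"
  shows "((\<lambda>s. a / s + \<eta> * (s - 1) + M * (norm (y - s *\<^sub>R w))\<^sup>2) has_real_derivative
    (- a / s\<^sup>2 + \<eta> - 2 * M * inner (y - s *\<^sub>R w) w)) (at s)"
proof -
  have "(norm (y - s *\<^sub>R w))\<^sup>2 = inner y y - 2 * s * inner y w + s\<^sup>2 * inner w w" for s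
    unfolding power2_norm_eq_inner
    by (simp add: inner_diff_left inner_diff_right inner_commute power2_eq_square)
  moreover have "((\<lambda>s. a / s + \<eta> * (s - 1) + M * (b - 2 * s * c + s\<^sup>2 * e)) has_real_derivative
      (- a / s\<^sup>2 + \<eta> - 2 * M * (c - s * e))) (at s)" for b c e :: real
    using assms by (auto intro!: derivative_eq_intros simp: power2_eq_square algebra_simps)
  ultimately show ?thesis by (simp add: inner_diff_left)
qed

text \<open>A quadratic error is negligible against \<open>\<epsilon>\<close> times the distance.
  Minimizers of quadratically penalized functions yield such estimates.\<close>

lemma reg_coderivI_quadratic:
  assumes "\<And>u'. inner z (u' - u) - inner d (F u' - F u) \<le> K * (norm (u' - u))\<^sup>2"
  shows "z \<in> reg_coderiv F u d"
  unfolding reg_coderiv_def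
proof (intro CollectI allI impI)
  fix \<epsilon> :: real assume e: "\<epsilon> > 0"
  show "\<exists>\<delta>>0. \<forall>u'. norm (u' - u) < \<delta> \<longrightarrow> inner z (u' - u) - inner d (F u' - F u) \<le> \<epsilon> * norm (u' - u)"
  proof (intro exI conjI allI impI)
    show "\<epsilon> / (\<bar>K\<bar> + 1) > 0" using e by (simp add: add_nonneg_pos)
    fix u' assume h: "norm (u' - u) < \<epsilon> / (\<bar>K\<bar> + 1)"
    have "K * norm (u' - u) \<le> (\<bar>K\<bar> + 1) * norm (u' - u)" by (intro mult_right_mono) auto
    also have "\<dots> \<le> \<epsilon>" using h by (simp add: field_simps)
    finally have "K * (norm (u' - u))\<^sup>2 \<le> \<epsilon> * norm (u' - u)"
      by (simp add: power2_eq_square mult_right_mono flip: mult.assoc)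
    then show "inner z (u' - u) - inner d (F u' - F u) \<le> \<epsilon> * norm (u' - u)"
      using assms[of u'] by linarith
  qed
qed

text \<open>The defining inequality is tested along the ray from \<open>u\<close> in direction
  \<open>e\<close>; dividing by \<open>s\<close> leaves \<open>K\<close> plus a small multiple of
  \<open>norm e\<close>. Coercivity and norm bounds below are instances.\<close>

lemma reg_coderiv_direction:
  assumes z: "z \<in> reg_coderiv F u d"
    and K: "\<And>s. 0 < s \<Longrightarrow> inner d (F (u + s *\<^sub>R e) - F u) \<le> s * K"
  shows "inner z e \<le> K"
proof (rule field_le_epsilon)
  fix \<eta> :: real assume eta: "\<eta> > 0"
  define \<epsilon> where "\<epsilon> = \<eta> / (norm e + 1)"
  have n: "norm e + 1 > 0" by (simp add: add_nonneg_pos)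
  have "\<epsilon> > 0" using eta n by (simp add: \<epsilon>_def)
  then obtain \<delta> where \<delta>: "\<delta> > 0" "\<And>u'. norm (u' - u) < \<delta> \<Longrightarrow>
     inner z (u' - u) - inner d (F u' - F u) \<le> \<epsilon> * norm (u' - u)"
    using z unfolding reg_coderiv_def by blast
  define s where "s = \<delta> / (norm e + 1)"
  have s: "s > 0" using \<delta> n by (simp add: s_def)
  have "s * norm e < \<delta>" using \<delta>(1) n by (simp add: s_def field_simps)
  then have "s * inner z e - inner d (F (u + s *\<^sub>R e) - F u) \<le> \<epsilon> * (s * norm e)"
    using \<delta>(2)[of "u + s *\<^sub>R e"] s by simp
  with K[OF s] have "s * inner z e \<le> s * (K + \<epsilon> * norm e)" by (simp add: algebra_simps)
  then have "inner z e \<le> K + \<epsilon> * norm e" using s by simp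
  also have "\<epsilon> * norm e \<le> \<eta>" using eta n by (simp add: \<epsilon>_def field_simps)
  finally show "inner z e \<le> K + \<eta>" by simp
qed

section \<open>Functions between two quadratic bounds: gradient and coderivative estimates\<close>

locale strongly_convex_C11 =
  fixes f :: "'a::euclidean_space \<Rightarrow> real" and F :: "'a \<Rightarrow> 'a" and \<mu> L :: real
  assumes mu_pos: "0 < \<mu>" and L_pos: "0 < L"
    and lower: "f u + inner (F u) (v - u) + \<mu> / 2 * (norm (v - u))\<^sup>2 \<le> f v"
    and upper: "f v \<le> f u + inner (F u) (v - u) + L / 2 * (norm (v - u))\<^sup>2"
    and lip: "norm (F u - F v) \<le> L * norm (u - v)"
begin

lemma strongly_monotone: "\<mu> * (norm (u - v))\<^sup>2 \<le> inner (F u - F v) (u - v)"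
  using lower[of u v] lower[of v u]
  by (simp add: norm_minus_commute algebra_simps inner_diff_left inner_diff_right)

lemma norm_grad_diff_ge: "\<mu> * norm (u - v) \<le> norm (F u - F v)"
proof (cases "u = v")
  case False
  have "\<mu> * norm (u - v) * norm (u - v) \<le> norm (F u - F v) * norm (u - v)"
    using strongly_monotone[of u v] norm_cauchy_schwarz[of "F u - F v" "u - v"]
    by (simp add: power2_eq_square mult.assoc)
  then show ?thesis using False by simp
qed simp

lemma continuous_grad: "continuous_on S F"
proof -
  have "L-lipschitz_on S F"
    using lip L_pos by (auto simp: lipschitz_on_def dist_norm)
  then show ?thesis by (rule lipschitz_on_continuous_on)
qed

text \<open>The remainder lies between \<open>0\<close> and \<open>L / 2\<close> times the squared
  distance, so the two quadratic bounds identify \<open>F\<close> as the gradient of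
  \<open>f\<close>.\<close>

lemma has_derivative_f: "(f has_derivative (\<lambda>h. inner (F u) h)) (at u)"
proof (rule has_derivativeI_sandwich[of 1])
  show "bounded_linear (inner (F u))" by (rule bounded_linear_inner_right)
  show "((\<lambda>y. L / 2 * norm (y - u)) \<longlongrightarrow> 0) (at u)"
    by (intro tendsto_mult_right_zero tendsto_norm_zero) (simp add: LIM_zero_iff)
  fix v assume "v \<noteq> u" "dist v u < 1"
  have "0 \<le> f v - f u - inner (F u) (v - u)"
    using lower[of u v] mu_pos zero_le_power2[of "norm (v - u)"]
    by (smt (verit) mult_nonneg_nonneg half_gt_zero)
  then have "norm (f v - f u - inner (F u) (v - u)) \<le> L / 2 * (norm (v - u))\<^sup>2"
    using upper[of v u] by simp
  then show "norm (f v - f u - inner (F u) (v - u)) / norm (v - u) \<le> L / 2 * norm (v - u)"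
    using \<open>v \<noteq> u\<close> by (simp add: field_simps power2_eq_square)
qed simp

text \<open>Nonsmooth counterpart of a Hessian bounded below by \<open>\<mu>\<close>: strong
  monotonicity along the ray in direction \<open>- d\<close> bounds the pairing of \<open>z\<close>
  with \<open>- d\<close>.\<close>

lemma reg_coderiv_coercive:
  assumes "z \<in> reg_coderiv F u d" shows "\<mu> * (norm d)\<^sup>2 \<le> inner z d"
proof -
  have "inner z (- d) \<le> - \<mu> * (norm d)\<^sup>2"
  proof (rule reg_coderiv_direction[OF assms])
    fix s :: real assume s: "0 < s"
    have "s * (s * \<mu> * (norm d)\<^sup>2) \<le> s * - inner d (F (u + s *\<^sub>R - d) - F u)"
      using strongly_monotone[of "u - s *\<^sub>R d" u]
      by (simp add: power_mult_distrib power2_eq_square inner_commute algebra_simps)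
    then have "s * \<mu> * (norm d)\<^sup>2 \<le> - inner d (F (u + s *\<^sub>R - d) - F u)"
      using s by (simp only: mult_le_cancel_left_pos)
    then show "inner d (F (u + s *\<^sub>R - d) - F u) \<le> s * (- \<mu> * (norm d)\<^sup>2)"
      using s by (simp add: algebra_simps)
  qed
  then show ?thesis by simp
qed

text \<open>The ray is taken along \<open>z\<close> itself, where the Lipschitz bound of
  \<open>F\<close> controls the difference quotients.\<close>

lemma reg_coderiv_norm_le:
  assumes "z \<in> reg_coderiv F u d" shows "norm z \<le> L * norm d"
proof (cases "z = 0")
  case False
  have "inner z z \<le> L * norm d * norm z"
  proof (rule reg_coderiv_direction[OF assms])
    fix s :: real assume s: "0 < s"
    have "inner d (F (u + s *\<^sub>R z) - F u) \<le> norm d * norm (F (u + s *\<^sub>R z) - F u)"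
      by (rule norm_cauchy_schwarz)
    also have "\<dots> \<le> norm d * (L * (s * norm z))"
      using lip[of "u + s *\<^sub>R z" u] s by (intro mult_left_mono) auto
    finally show "inner d (F (u + s *\<^sub>R z) - F u) \<le> s * (L * norm d * norm z)"
      by (simp add: algebra_simps)
  qed
  then have "norm z * norm z \<le> L * norm d * norm z"
    by (simp flip: power2_norm_eq_inner add: power2_eq_square)
  then show ?thesis using False by simp
qed (use L_pos in simp)

text \<open>For \<open>z = - F u\<close> the first bound makes a nonzero \<open>d\<close> a descent
  direction, and the second bounds its length below by a multiple of
  \<open>norm (F u)\<close>.\<close>

lemma lim_coderiv_bounds:
  assumes "z \<in> lim_coderiv F u d"
  shows "\<mu> * (norm d)\<^sup>2 \<le> inner z d" "norm z \<le> L * norm d"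
proof -
  obtain us ds zs where *: "\<And>k. zs k \<in> reg_coderiv F (us k) (ds k)" "ds \<longlonglongrightarrow> d" "zs \<longlonglongrightarrow> z"
    using assms unfolding lim_coderiv_def by blast
  show "\<mu> * (norm d)\<^sup>2 \<le> inner z d"
  proof (rule LIMSEQ_le)
    show "(\<lambda>k. \<mu> * (norm (ds k))\<^sup>2) \<longlonglongrightarrow> \<mu> * (norm d)\<^sup>2" by (intro tendsto_intros *)
    show "(\<lambda>k. inner (zs k) (ds k)) \<longlonglongrightarrow> inner z d" by (intro tendsto_intros *)
  qed (use reg_coderiv_coercive[OF *(1)] in blast)
  show "norm z \<le> L * norm d"
  proof (rule LIMSEQ_le)
    show "(\<lambda>k. norm (zs k)) \<longlonglongrightarrow> norm z" by (intro tendsto_intros *)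
    show "(\<lambda>k. L * norm (ds k)) \<longlonglongrightarrow> L * norm d" by (intro tendsto_intros *)
  qed (use reg_coderiv_norm_le[OF *(1)] in blast)
qed

section \<open>Existence of Newton directions\<close>

text \<open>Penalization: at a minimizer \<open>v\<close> of \<open>M |F v - F u|\<^sup>2 - \<langle>z, v\<rangle>\<close> the vector \<open>z\<close> is a
  regular coderivative value in the direction \<open>2 M (F v - F u)\<close>, and the latter stays
  bounded as \<open>M\<close> grows.\<close>

lemma reg_coderiv_penalization:
  assumes M: "M > 0"
  obtains v d where "z \<in> reg_coderiv F v d" "norm d \<le> 2 * norm z / \<mu>" "norm (v - u) \<le> norm z / (M * \<mu>\<^sup>2)"
proof -
  define \<Phi> where "\<Phi> v = M * (norm (F v - F u))\<^sup>2 - inner z v" for v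
  define R where "R = norm z / (M * \<mu>\<^sup>2)"
  have R: "R \<ge> 0" using M by (simp add: R_def)
  \<comment> \<open>Points not above \<open>\<Phi> u\<close> lie within distance \<open>R\<close> of
    \<open>u\<close>, by \<open>norm_grad_diff_ge\<close>; a minimizer over the compact ball is
    therefore a global one.\<close>
  have near: "M * norm (F v - F u) \<le> norm z / \<mu>" "norm (v - u) \<le> R" if le: "\<Phi> v \<le> \<Phi> u" for v
  proof -
    have a: "\<mu> * norm (v - u) \<le> norm (F v - F u)" by (rule norm_grad_diff_ge)
    have "M * (norm (F v - F u))\<^sup>2 \<le> inner z (v - u)"
      using le by (simp add: \<Phi>_def inner_diff_right)
    also have "\<dots> \<le> norm z * norm (v - u)" by (rule norm_cauchy_schwarz)
    also have "\<dots> \<le> norm z * (norm (F v - F u) / \<mu>)"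
      using a mu_pos by (intro mult_left_mono) (auto simp: field_simps)
    finally have "(M * norm (F v - F u)) * norm (F v - F u) \<le> (norm z / \<mu>) * norm (F v - F u)"
      by (simp add: power2_eq_square algebra_simps)
    then show b: "M * norm (F v - F u) \<le> norm z / \<mu>"
      using mu_pos by (cases "F v = F u") (auto simp del: times_divide_eq_left)
    have "M * (\<mu> * norm (v - u)) \<le> norm z / \<mu>"
      using mult_left_mono[OF a, of M] M b by linarith
    then show "norm (v - u) \<le> R"
      using M mu_pos by (simp add: R_def field_simps power2_eq_square)
  qed
  have "continuous_on (cball u R) \<Phi>"
    unfolding \<Phi>_def by (intro continuous_intros continuous_grad)
  then obtain v where v: "v \<in> cball u R" "\<And>w. w \<in> cball u R \<Longrightarrow> \<Phi> v \<le> \<Phi> w"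
    using continuous_attains_inf[of "cball u R" \<Phi>] R by auto
  have vu: "\<Phi> v \<le> \<Phi> u" using v(2)[of u] R by simp
  have min: "\<Phi> v \<le> \<Phi> w" for w
  proof (cases "\<Phi> w \<le> \<Phi> u")
    case True
    then show ?thesis using near(2)[OF True] v(2)[of w] by (simp add: dist_norm norm_minus_commute)
  qed (use vu in simp)
  \<comment> \<open>This is the gradient of the squared penalty at the residual
    \<open>F v - F u\<close>; the rest of the expansion is quadratic in \<open>F w - F v\<close>,
    hence in \<open>w - v\<close>.\<close>
  define d where "d = (2 * M) *\<^sub>R (F v - F u)"
  have "z \<in> reg_coderiv F v d"
  proof (rule reg_coderivI_quadratic)
    fix w
    have "(norm (F w - F u))\<^sup>2 = (norm (F v - F u))\<^sup>2 + 2 * inner (F v - F u) (F w - F v) + (norm (F w - F v))\<^sup>2"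
      by (rule norm_diff_square_expand)
    then have "M * (norm (F w - F u))\<^sup>2 = M * (norm (F v - F u))\<^sup>2 + inner d (F w - F v) + M * (norm (F w - F v))\<^sup>2"
      by (simp add: d_def distrib_left)
    then have "inner z (w - v) - inner d (F w - F v) \<le> M * (norm (F w - F v))\<^sup>2"
      using min[of w] by (simp add: \<Phi>_def inner_diff_right[of z])
    also have "\<dots> \<le> M * (L * norm (w - v))\<^sup>2"
      using M lip by (intro mult_left_mono power_mono) auto
    finally show "inner z (w - v) - inner d (F w - F v) \<le> (M * L\<^sup>2) * (norm (w - v))\<^sup>2"
      by (simp add: power_mult_distrib)
  qed
  moreover have "norm d \<le> 2 * norm z / \<mu>"
    using near(1)[OF vu] M by (simp add: d_def)
  ultimately show thesis using that near(2)[OF vu] by (simp add: R_def)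
qed

text \<open>Penalty weights \<open>Suc k\<close> force the base points to \<open>u\<close> while the
  directions stay in a fixed ball, so a subsequence supplies \<open>d\<close>. The value
  \<open>z\<close> is the same throughout.\<close>

lemma ex_lim_coderiv: "\<exists>d. z \<in> lim_coderiv F u d"
proof -
  have "\<exists>v d. z \<in> reg_coderiv F v d \<and> norm d \<le> 2 * norm z / \<mu> \<and> norm (v - u) \<le> norm z / (real (Suc k) * \<mu>\<^sup>2)" for k
    using reg_coderiv_penalization[of "real (Suc k)" z u] by (metis of_nat_0_less_iff zero_less_Suc)
  then obtain vs ds where *: "\<And>k. z \<in> reg_coderiv F (vs k) (ds k)" "\<And>k. norm (ds k) \<le> 2 * norm z / \<mu>"
    "\<And>k. norm (vs k - u) \<le> norm z / (real (Suc k) * \<mu>\<^sup>2)" by metis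
  have lim: "(\<lambda>k. vs k - u) \<longlonglongrightarrow> 0"
  proof (rule Lim_null_comparison)
    show "\<forall>\<^sub>F k in sequentially. norm (vs k - u) \<le> norm z / \<mu>\<^sup>2 * (1 / real (Suc k))"
      using *(3) by (simp add: mult.commute)
    show "(\<lambda>k. norm z / \<mu>\<^sup>2 * (1 / real (Suc k))) \<longlonglongrightarrow> 0"
      by (intro tendsto_mult_right_zero LIMSEQ_Suc[OF lim_1_over_n])
  qed
  then have lim: "vs \<longlonglongrightarrow> u" by (simp add: LIM_zero_iff)
  have "compact (cball (0::'a) (2 * norm z / \<mu>))" by simp
  moreover have "\<forall>k. ds k \<in> cball 0 (2 * norm z / \<mu>)" using *(2) by simp
  ultimately obtain d r where "strict_mono (r :: nat \<Rightarrow> nat)" "(ds \<circ> r) \<longlonglongrightarrow> d"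
    unfolding compact_def by blast
  then have "\<forall>k. z \<in> reg_coderiv F ((vs \<circ> r) k) ((ds \<circ> r) k)" "(vs \<circ> r) \<longlonglongrightarrow> u" "(ds \<circ> r) \<longlonglongrightarrow> d"
    using *(1) LIMSEQ_subseq_LIMSEQ[OF lim] by auto
  then have "z \<in> lim_coderiv F u d"
    unfolding lim_coderiv_def
    by (intro CollectI exI[of _ "vs \<circ> r"] exI[of _ "ds \<circ> r"] exI[of _ "\<lambda>_. z"]) auto
  then show ?thesis ..
qed

section \<open>Radial scaling of the gradient under semismoothness\<close>

text \<open>A mean value argument for the nonsmooth function \<open>s \<mapsto> \<langle>d, F (ub + s w)\<rangle> / s\<close>: the segment is
  relaxed by a quadratic penalty so that a regular coderivative value appears at the minimizer.\<close>

lemma radial_scaling_lower: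
  assumes zero: "F ub = 0" and eps: "\<epsilon> > 0"
    and semi: "\<And>u d z. norm (u - ub) < \<delta> \<Longrightarrow> z \<in> reg_coderiv F u d \<Longrightarrow>
        \<bar>inner z (u - ub) - inner d (F u - F ub)\<bar> \<le> \<epsilon> * norm (u - ub) * norm d"
    and t: "1 < t" "t * norm w < \<delta>"
  shows "inner d (F (ub + w)) - \<epsilon> * norm w * norm d * (t - 1) \<le> inner d (F (ub + t *\<^sub>R w)) / t"
proof (rule ccontr)
  define h where "h y = inner d (F (ub + y))" for y
  define D where "D = norm d"
  assume "\<not> ?thesis"
  then have "h (t *\<^sub>R w) / t + \<epsilon> * norm w * D * (t - 1) < h w" by (simp add: h_def D_def)
  then have gap: "0 < (h w - h (t *\<^sub>R w) / t) / (t - 1) - \<epsilon> * norm w * D"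
    using t by (simp add: field_simps)
  \<comment> \<open>The midpoint between the error allowed by \<open>\<epsilon>\<close> and the
    slope produced by the negated claim; both strict gaps are used below.\<close>
  define \<eta> where "\<eta> = \<epsilon> * norm w * D + ((h w - h (t *\<^sub>R w) / t) / (t - 1) - \<epsilon> * norm w * D) / 2"
  have eta1: "\<epsilon> * norm w * D < \<eta>" using gap by (simp add: \<eta>_def)
  have "\<eta> < (h w - h (t *\<^sub>R w)/ t) / (t - 1)"
  proof -
    have "a + (b - a) / 2 < b" if "0 < b - a" for a b :: real using that by (simp add: field_simps)
    from this[OF gap] show ?thesis by (simp only: \<eta>_def)
  qed
  then have eta2: "h (t *\<^sub>R w) / t + \<eta> * (t - 1) < h w" using t by (simp add: pos_less_divide_eq)
  have eta0: "\<eta> > 0" using eta1 eps by (smt (verit) D_def mult_nonneg_nonneg norm_ge_zero)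
  have lim0: "((\<lambda>M. c * inverse M) \<longlongrightarrow> 0) at_top" for c :: real
    by (intro tendsto_mult_right_zero tendsto_inverse_0_at_top filterlim_ident)
  have "\<forall>\<^sub>F M in at_top. M > 0 \<and> L * D * inverse M < \<delta> - t * norm w \<and>
      L\<^sup>2 * D\<^sup>2 * inverse M < h w - (h (t *\<^sub>R w) / t + \<eta> * (t - 1)) \<and>
      \<epsilon> * D\<^sup>2 * L * inverse M < \<eta> - \<epsilon> * norm w * D"
    using eta1 eta2 t by (intro eventually_conj eventually_gt_at_top order_tendstoD(2)[OF lim0]) auto
  \<comment> \<open>The three bounds keep minimizers within \<open>\<delta>\<close>, exclude the
    endpoint \<open>s = 1\<close>, and keep the final error below \<open>\<eta>\<close>.\<close>
  then obtain M where M: "M > 0" "L * D * inverse M < \<delta> - t * norm w"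
      "L\<^sup>2 * D\<^sup>2 * inverse M < h w - (h (t *\<^sub>R w) / t + \<eta> * (t - 1))"
      "\<epsilon> * D\<^sup>2 * L * inverse M < \<eta> - \<epsilon> * norm w * D"
    using eventually_happens'[OF trivial_limit_at_top_linorder] by blast
  have h_lip: "\<bar>h y - h y'\<bar> \<le> L * D * norm (y - y')" for y y'
  proof -
    have "\<bar>h y - h y'\<bar> \<le> D * norm (F (ub + y) - F (ub + y'))"
      unfolding h_def D_def inner_diff_right[symmetric] by (rule Cauchy_Schwarz_ineq2)
    also have "\<dots> \<le> D * (L * norm (y - y'))"
      using lip[of "ub + y" "ub + y'"] by (intro mult_left_mono) (auto simp: D_def)
    finally show ?thesis by (simp add: algebra_simps)
  qed
  define R where "R = t * norm w + L * D * inverse M"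
  \<comment> \<open>On the ray \<open>y = s *\<^sub>R w\<close> the penalty vanishes and only the
    scaled value plus a linear term of slope \<open>\<eta>\<close> is left.\<close>
  define \<Phi> where "\<Phi> s y = h y / s + \<eta> * (s - 1) + M * (norm (y - s *\<^sub>R w))\<^sup>2" for s y
  have R0: "R \<ge> 0" using t L_pos M by (auto simp: R_def D_def)
  have near: "norm (y - s *\<^sub>R w) \<le> L * D * inverse M" "norm y \<le> R" if s: "1 \<le> s" "s \<le> t" and le: "\<Phi> s y \<le> \<Phi> s (s *\<^sub>R w)" for s y
  proof -
    have "M * (norm (y - s *\<^sub>R w))\<^sup>2 \<le> (h (s *\<^sub>R w) - h y) / s"
      using le by (simp add: \<Phi>_def diff_divide_distrib)
    also have "\<dots> \<le> (L * D * norm (y - s *\<^sub>R w)) / s"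
      using h_lip[of "s *\<^sub>R w" y] s by (intro divide_right_mono) (auto simp: norm_minus_commute)
    also have "\<dots> \<le> L * D * norm (y - s *\<^sub>R w)"
      using s L_pos by (simp add: divide_le_eq mult_left_le D_def)
        (metis mult_left_mono mult.right_neutral mult_nonneg_nonneg less_imp_le norm_ge_zero)
    finally have "(M * norm (y - s *\<^sub>R w)) * norm (y - s *\<^sub>R w) \<le> (L * D) * norm (y - s *\<^sub>R w)"
      by (simp add: power2_eq_square)
    then have "M * norm (y - s *\<^sub>R w) \<le> L * D"
      using L_pos by (cases "y = s *\<^sub>R w") (auto simp: D_def)
    then show a: "norm (y - s *\<^sub>R w) \<le> L * D * inverse M"
      using M by (simp add: field_simps)
    have "norm y \<le> norm (s *\<^sub>R w) + norm (y - s *\<^sub>R w)" by (rule norm_triangle_sub)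
    also have "norm (s *\<^sub>R w) \<le> t * norm w" using s by (simp add: mult_right_mono)
    finally show "norm y \<le> R" using a by (simp add: R_def)
  qed
  have "continuous_on ({1..t} \<times> cball 0 R) (\<lambda>(s, y). \<Phi> s y)"
    unfolding \<Phi>_def h_def case_prod_unfold
    by (intro continuous_intros continuous_on_compose2[OF continuous_grad[of UNIV]]) auto
  moreover have "compact ({1..t} \<times> cball (0::'a) R)" by (intro compact_Times) auto
  moreover have "{1..t} \<times> cball (0::'a) R \<noteq> {}" using t R0 by auto
  ultimately have "\<exists>q\<in>{1..t} \<times> cball (0::'a) R. \<forall>q'\<in>{1..t} \<times> cball (0::'a) R.
      (\<lambda>(s, y). \<Phi> s y) q \<le> (\<lambda>(s, y). \<Phi> s y) q'"
    by (intro continuous_attains_inf) auto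
  then obtain s y where s: "1 \<le> s" "s \<le> t" and y: "norm y \<le> R"
    and min0: "\<And>s' y'. 1 \<le> s' \<Longrightarrow> s' \<le> t \<Longrightarrow> norm y' \<le> R \<Longrightarrow> \<Phi> s y \<le> \<Phi> s' y'"
    by fastforce
  have swR: "norm (s' *\<^sub>R w) \<le> R" if "1 \<le> s'" "s' \<le> t" for s'
    using near(2)[OF that, of "s' *\<^sub>R w"] by simp
  have min: "\<Phi> s y \<le> \<Phi> s' y'" if "1 \<le> s'" "s' \<le> t" for s' y'
  proof (cases "\<Phi> s' y' \<le> \<Phi> s' (s' *\<^sub>R w)")
    case True
    then show ?thesis using near(2)[OF that True] min0[OF that] by blast
  qed (use min0[OF that swR[OF that]] in linarith)
  have ysw: "norm (y - s *\<^sub>R w) \<le> L * D * inverse M" using near(1)[OF s min[OF s]] .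
  \<comment> \<open>At \<open>s = 1\<close> the minimum would be nearly as large as
    \<open>h w\<close>, but the competitor \<open>t *\<^sub>R w\<close> at \<open>s = t\<close> lies
    below that by the choice of \<open>\<eta>\<close> and \<open>M\<close>.\<close>
  have sgt: "s > 1"
  proof (rule ccontr)
    assume "\<not> s > 1"
    then have s1: "s = 1" using s by simp
    have "h w - L * D * norm (y - w) \<le> h y" using h_lip[of w y] by (auto simp: norm_minus_commute)
    also have "h y \<le> \<Phi> s y" using M by (simp add: \<Phi>_def s1)
    also have "\<dots> \<le> \<Phi> t (t *\<^sub>R w)" using t by (intro min) auto
    also have "\<dots> = h (t *\<^sub>R w) / t + \<eta> * (t - 1)" by (simp add: \<Phi>_def)
    finally have "h w - (h (t *\<^sub>R w) / t + \<eta> * (t - 1)) \<le> L * D * norm (y - w)" by simp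
    also have "\<dots> \<le> L * D * (L * D * inverse M)"
      using ysw L_pos by (intro mult_left_mono) (auto simp: s1 D_def)
    finally show False using M(3) by (simp add: power2_eq_square algebra_simps)
  qed
  \<comment> \<open>Minimality in \<open>y\<close>, multiplied by \<open>s\<close>: \<open>z\<close>
    is \<open>- s\<close> times the gradient of the penalty in \<open>y\<close>.\<close>
  define z where "z = (- (2 * M * s)) *\<^sub>R (y - s *\<^sub>R w)"
  have z: "z \<in> reg_coderiv F (ub + y) d"
  proof (rule reg_coderivI_quadratic)
    fix u'
    define y' where "y' = u' - ub"
    have u': "u' = ub + y'" by (simp add: y'_def)
    have "(norm (y' - s *\<^sub>R w))\<^sup>2 = (norm (y - s *\<^sub>R w))\<^sup>2 + 2 * inner (y - s *\<^sub>R w) (y' - y) + (norm (y' - y))\<^sup>2"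
      by (rule norm_diff_square_expand)
    then have "h y / s \<le> h y' / s + M * (2 * inner (y - s *\<^sub>R w) (y' - y) + (norm (y' - y))\<^sup>2)"
      using min[OF s, of y'] by (simp add: \<Phi>_def distrib_left)
    then have "s * (h y / s) \<le> s * (h y' / s + M * (2 * inner (y - s *\<^sub>R w) (y' - y) + (norm (y' - y))\<^sup>2))"
      using s by (intro mult_left_mono) auto
    then have "h y \<le> h y' + s * M * (2 * inner (y - s *\<^sub>R w) (y' - y) + (norm (y' - y))\<^sup>2)"
      using s by (simp add: distrib_left mult.assoc)
    then show "inner z (u' - (ub + y)) - inner d (F u' - F (ub + y)) \<le> (M * s) * (norm (u' - (ub + y)))\<^sup>2"
      by (simp add: u' z_def h_def inner_diff_right algebra_simps)
  qed
  have der: "((\<lambda>s. \<Phi> s y) has_real_derivative (- h y / s\<^sup>2 + \<eta> - 2 * M * inner (y - s *\<^sub>R w) w)) (at s)"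
    unfolding \<Phi>_def using s by (intro penalized_ray_derivative) simp
  have "- h y / s\<^sup>2 + \<eta> - 2 * M * inner (y - s *\<^sub>R w) w \<le> 0"
  proof (rule ccontr)
    assume "\<not> ?thesis"
    then obtain r where r: "r > 0" "\<And>k. 0 < k \<Longrightarrow> k < r \<Longrightarrow> \<Phi> (s - k) y < \<Phi> s y"
      using DERIV_pos_inc_left[OF der] by auto
    \<comment> \<open>\<open>s\<close> may equal \<open>t\<close>, so only moves to the left are
      used; \<open>sgt\<close> keeps \<open>s - k\<close> in the interval.\<close>
    define k where "k = min (r / 2) (s - 1)"
    have k: "0 < k" "k < r" "1 \<le> s - k" "s - k \<le> t" using r(1) sgt s by (auto simp: k_def)
    show False using r(2)[OF k(1,2)] min[OF k(3,4), of y] by simp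
  qed
  then have "s\<^sup>2 * (- h y / s\<^sup>2 + \<eta> - 2 * M * inner (y - s *\<^sub>R w) w) \<le> 0"
    by (simp add: mult_nonneg_nonpos)
  then have "s\<^sup>2 * \<eta> + inner z (s *\<^sub>R w) \<le> h y"
    using s by (simp add: z_def algebra_simps power2_eq_square inner_diff_left)
  moreover have "inner z y \<le> inner z (s *\<^sub>R w)"
  proof -
    have "inner z (y - s *\<^sub>R w) = - (2 * M * s * (norm (y - s *\<^sub>R w))\<^sup>2)"
      by (simp add: z_def power2_norm_eq_inner)
    also have "\<dots> \<le> 0" using M s by simp
    finally show ?thesis by (simp add: inner_diff_right)
  qed
  moreover have "h y - \<epsilon> * norm y * D \<le> inner z y"
  proof -
    have "norm (ub + y - ub) < \<delta>" using y M by (simp add: R_def)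
    from semi[OF this z] show ?thesis by (simp add: zero h_def D_def)
  qed
  \<comment> \<open>Minimality in \<open>s\<close> and in \<open>y\<close> combine with the
    semismooth estimate at \<open>ub + y\<close>. As \<open>norm y\<close> is at most
    \<open>s\<close> times nearly \<open>norm w\<close>, this pushes \<open>\<eta>\<close> down to
    almost the allowed error, against its choice.\<close>
  ultimately have "s\<^sup>2 * \<eta> \<le> \<epsilon> * norm y * D" by linarith
  also have "\<dots> \<le> \<epsilon> * (s * (norm w + L * D * inverse M)) * D"
  proof -
    have "norm y \<le> norm (s *\<^sub>R w) + norm (y - s *\<^sub>R w)" by (rule norm_triangle_sub)
    also have "\<dots> \<le> s * norm w + 1 * (L * D * inverse M)" using ysw s by simp
    also have "\<dots> \<le> s * norm w + s * (L * D * inverse M)"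
      using s L_pos M by (intro add_left_mono mult_right_mono) (auto simp: D_def)
    finally show ?thesis
      using eps by (intro mult_right_mono mult_left_mono) (auto simp: D_def algebra_simps)
  qed
  finally have "s * (s * \<eta>) \<le> s * (\<epsilon> * norm w * D + \<epsilon> * D\<^sup>2 * L * inverse M)"
    by (simp add: power2_eq_square algebra_simps)
  then have "s * \<eta> \<le> \<epsilon> * norm w * D + \<epsilon> * D\<^sup>2 * L * inverse M" using s by simp
  moreover have "\<eta> \<le> s * \<eta>" using s eta0 by simp
  ultimately show False using M(4) by linarith
qed

text \<open>\<open>radial_scaling_lower\<close> is applied with \<open>d\<close> equal to minus the
  difference to be estimated, so that the pairing becomes its squared norm.\<close>

lemma radial_scaling:
  assumes "F ub = 0" "\<epsilon> > 0"
    and "\<And>u d z. norm (u - ub) < \<delta> \<Longrightarrow> z \<in> reg_coderiv F u d \<Longrightarrow>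
        \<bar>inner z (u - ub) - inner d (F u - F ub)\<bar> \<le> \<epsilon> * norm (u - ub) * norm d"
    and t: "1 < t" "t * norm w < \<delta>"
  shows "norm (F (ub + t *\<^sub>R w) /\<^sub>R t - F (ub + w)) \<le> \<epsilon> * norm w * (t - 1)"
proof -
  define D where "D = F (ub + t *\<^sub>R w) /\<^sub>R t - F (ub + w)"
  have "inner (- D) (F (ub + w)) - \<epsilon> * norm w * norm (- D) * (t - 1) \<le> inner (- D) (F (ub + t *\<^sub>R w)) / t"
    by (rule radial_scaling_lower[where \<delta>=\<delta>]) (use assms in auto)
  then have "inner D D \<le> \<epsilon> * norm w * norm D * (t - 1)"
    by (subst (2) D_def) (simp add: inner_diff_right field_simps)
  then have "norm D * norm D \<le> (\<epsilon> * norm w * (t - 1)) * norm D"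
    by (simp flip: power2_norm_eq_inner add: power2_eq_square mult.commute mult.left_commute)
  then have "norm D \<le> \<epsilon> * norm w * (t - 1)"
    using assms(2) t by (cases "D = 0") auto
  then show ?thesis by (simp add: D_def)
qed

section \<open>The Euler defect and superlinear Newton points\<close>

text \<open>The function \<open>\<langle>F u, u - ub\<rangle> - 2 f u\<close> is the derivative of \<open>f (ub + t (u - ub)) / t\<^sup>2\<close> at \<open>t = 1\<close>,
  hence a limit of difference quotients whose gradients are controlled by radial scaling. This
  replaces the symmetry of the Hessian.\<close>

lemma euler_defect_lipschitz:
  assumes zero: "F ub = 0" and eps: "\<epsilon> > 0"
    and semi: "\<And>u d z. norm (u - ub) < \<delta> \<Longrightarrow> z \<in> reg_coderiv F u d \<Longrightarrow>
        \<bar>inner z (u - ub) - inner d (F u - F ub)\<bar> \<le> \<epsilon> * norm (u - ub) * norm d"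
    and r: "r < \<delta>" "norm (u - ub) \<le> r" "norm (v - ub) \<le> r"
  shows "\<bar>(inner (F u) (u - ub) - 2 * f u) - (inner (F v) (v - ub) - 2 * f v)\<bar> \<le> \<epsilon> * r * norm (u - v)"
proof -
  \<comment> \<open>The difference quotient at \<open>1\<close> of the function sending
    \<open>t\<close> to \<open>f (ub + t *\<^sub>R w) / t\<^sup>2\<close>.\<close>
  define q where "q t w = (f (ub + t *\<^sub>R w) / t\<^sup>2 - f (ub + w)) / (t - 1)" for t w
  have r0: "r \<ge> 0" using r(2) norm_ge_zero order_trans by blast
  have lim: "((\<lambda>t. q t w) \<longlongrightarrow> inner (F (ub + w)) w - 2 * f (ub + w)) (at_right 1)" for w
  proof -
    have d1: "((\<lambda>t. f (ub + t *\<^sub>R w)) has_derivative (\<lambda>h. inner (F (ub + 1 *\<^sub>R w)) (h *\<^sub>R w))) (at 1)"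
      by (rule has_derivative_compose[of "\<lambda>t. ub + t *\<^sub>R w" "\<lambda>h. h *\<^sub>R w" 1 UNIV f, OF _ has_derivative_f])
        (auto intro!: derivative_eq_intros)
    then have "((\<lambda>t. f (ub + t *\<^sub>R w)) has_real_derivative inner (F (ub + w)) w) (at 1)"
      by (simp add: has_field_derivative_def mult.commute[of _ "inner _ _"])
    then have "((\<lambda>t. f (ub + t *\<^sub>R w) / t\<^sup>2) has_real_derivative (inner (F (ub + w)) w - 2 * f (ub + w))) (at 1)"
      by (auto intro!: derivative_eq_intros)
    then have "((\<lambda>t. q t w) \<longlongrightarrow> inner (F (ub + w)) w - 2 * f (ub + w)) (at 1)"
      by (simp add: has_field_derivative_iff q_def)
    then show ?thesis by (rule tendsto_within_subset) simp
  qed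
  have bound: "\<bar>q t (u - ub) - q t (v - ub)\<bar> \<le> \<epsilon> * r * norm (u - v)" if t: "1 < t" "t * r < \<delta>" for t
  proof -
    \<comment> \<open>The gradient of \<open>q t\<close>: the chain rule factor \<open>t\<close>
      cancels one power in the denominator. \<open>radial_scaling\<close> bounds it by
      \<open>\<epsilon> * norm w\<close>.\<close>
    define G where "G w = (F (ub + t *\<^sub>R w) /\<^sub>R t - F (ub + w)) /\<^sub>R (t - 1)" for w
    have der: "(q t has_derivative (\<lambda>h. inner (G w) h)) (at w within cball 0 r)" for w
    proof -
      have d1: "((\<lambda>w. f (ub + t *\<^sub>R w)) has_derivative (\<lambda>h. inner (F (ub + t *\<^sub>R w)) (t *\<^sub>R h))) (at w within cball 0 r)"
        by (rule has_derivative_compose[of "\<lambda>w. ub + t *\<^sub>R w" "\<lambda>h. t *\<^sub>R h" w _ f, OF _ has_derivative_f])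
          (auto intro!: derivative_eq_intros)
      have d2: "((\<lambda>w. f (ub + w)) has_derivative (\<lambda>h. inner (F (ub + w)) h)) (at w within cball 0 r)"
        by (rule has_derivative_compose[of "\<lambda>w. ub + w" "\<lambda>h. h" w _ f, OF _ has_derivative_f])
          (auto intro!: derivative_eq_intros)
      have "((\<lambda>w. (f (ub + t *\<^sub>R w) * inverse (t\<^sup>2) - f (ub + w)) * inverse (t - 1)) has_derivative
          (\<lambda>h. (inner (F (ub + t *\<^sub>R w)) (t *\<^sub>R h) * inverse (t\<^sup>2) - inner (F (ub + w)) h) * inverse (t - 1)))
          (at w within cball 0 r)"
        by (intro has_derivative_mult_left has_derivative_diff d1 d2)
      moreover have "(inner (F (ub + t *\<^sub>R w)) (t *\<^sub>R h) * inverse (t\<^sup>2) - inner (F (ub + w)) h) * inverse (t - 1) = inner (G w) h" for h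
        using t by (simp add: G_def inner_diff_left power2_eq_square)
      ultimately show ?thesis by (simp add: q_def[abs_def] divide_inverse)
    qed
    have "norm (q t (u - ub) - q t (v - ub)) \<le> \<epsilon> * r * norm ((u - ub) - (v - ub))"
    proof (rule differentiable_bound[of "cball 0 r" "q t" "\<lambda>w h. inner (G w) h"])
      fix w assume w: "w \<in> cball (0::'a) r"
      then have "t * norm w \<le> t * r" using t by simp
      then have tw: "t * norm w < \<delta>" using t(2) by (rule le_less_trans)
      have "norm (F (ub + t *\<^sub>R w) /\<^sub>R t - F (ub + w)) \<le> \<epsilon> * norm w * (t - 1)"
        by (rule radial_scaling[OF zero eps semi t(1) tw])
      also have "\<dots> \<le> \<epsilon> * r * (t - 1)"
        using w eps t by (intro mult_right_mono mult_left_mono) auto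
      finally have "norm (F (ub + t *\<^sub>R w) /\<^sub>R t - F (ub + w)) / (t - 1) \<le> \<epsilon> * r"
        using t by (simp add: pos_divide_le_eq)
      then have "norm (G w) \<le> \<epsilon> * r" using t by (simp add: G_def divide_inverse mult.commute)
      then show "onorm (\<lambda>h. inner (G w) h) \<le> \<epsilon> * r"
        using eps r0 by (intro onorm_bound)
          (auto intro!: order_trans[OF Cauchy_Schwarz_ineq2[of "G w"]] mult_right_mono)
    qed (use der r in auto)
    then show ?thesis by simp
  qed
  have "\<forall>\<^sub>F t in at_right 1. \<bar>q t (u - ub) - q t (v - ub)\<bar> \<le> \<epsilon> * r * norm (u - v)"
  proof -
    \<comment> \<open>The strict inequality \<open>r < \<delta>\<close> leaves room to stretch the
      ball by factors close to \<open>1\<close>.\<close>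
    have "((\<lambda>t. t * r) \<longlongrightarrow> 1 * r) (at_right 1)" by (intro tendsto_intros)
    then have "\<forall>\<^sub>F t in at_right 1. t * r < \<delta>" using r by (intro order_tendstoD) auto
    moreover have "\<forall>\<^sub>F t in at_right (1::real). 1 < t" by (simp add: eventually_at_right_less)
    ultimately show ?thesis by eventually_elim (use bound in blast)
  qed
  moreover have "((\<lambda>t. \<bar>q t (u - ub) - q t (v - ub)\<bar>) \<longlongrightarrow>
      \<bar>(inner (F (ub + (u - ub))) (u - ub) - 2 * f (ub + (u - ub))) -
      (inner (F (ub + (v - ub))) (v - ub) - 2 * f (ub + (v - ub)))\<bar>) (at_right 1)"
    by (intro tendsto_rabs tendsto_diff lim)
  ultimately have "\<bar>(inner (F (ub + (u - ub))) (u - ub) - 2 * f (ub + (u - ub))) -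
      (inner (F (ub + (v - ub))) (v - ub) - 2 * f (ub + (v - ub)))\<bar> \<le> \<epsilon> * r * norm (u - v)"
    by (intro tendsto_upperbound[OF _ _ trivial_limit_at_right_real])
  then show ?thesis by simp
qed

text \<open>With \<open>e = u + d - ub\<close>, the coderivative inequality is tested at
  \<open>u - s *\<^sub>R e\<close>, and strong monotonicity there bounds \<open>norm e\<close>. The
  residual \<open>z + F u\<close> is kept because the regular values behind a limiting one only
  approximate \<open>- F u\<close>.\<close>

lemma newton_point_bound:
  assumes z: "z \<in> reg_coderiv F u d" and rho: "\<rho> > 0"
    and K: "\<And>v. norm (v - u) < \<rho> \<Longrightarrow>
      \<bar>(inner (F v) (v - ub) - 2 * f v) - (inner (F u) (u - ub) - 2 * f u)\<bar> \<le> K * norm (v - u)"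
  shows "\<mu> * norm (u + d - ub) \<le> norm (z + F u) + K"
proof (cases "u + d - ub = 0")
  case True
  \<comment> \<open>Only \<open>0 \<le> K\<close> is at stake here; the hypothesis at any nearby
    point other than \<open>u\<close> gives it.\<close>
  obtain v where v: "norm (v - u) < \<rho>" "v \<noteq> u"
  proof -
    obtain e :: 'a where "norm e = \<rho> / 2" using vector_choose_size[of "\<rho> / 2"] rho by auto
    then show thesis using that[of "u + e"] rho by auto
  qed
  then have "0 \<le> K * norm (v - u)" using K[OF v(1)] by linarith
  then have "0 \<le> K" using v by (simp add: zero_le_mult_iff)
  then show ?thesis using True by simp
next
  case False
  define e where "e = u + d - ub"
  have e: "norm e > 0" using False by (simp add: e_def)
  show ?thesis
  proof (rule field_le_epsilon)
    fix \<eta> :: real assume eta: "\<eta> > 0"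
    then have "\<eta> / 2 > 0" by simp
    then obtain \<delta> where \<delta>: "\<delta> > 0" "\<And>v. norm (v - u) < \<delta> \<Longrightarrow>
       inner z (v - u) - inner d (F v - F u) \<le> \<eta> / 2 * norm (v - u)"
      using z unfolding reg_coderiv_def by blast
    \<comment> \<open>The step stays within \<open>\<delta>\<close> and \<open>\<rho>\<close>, and
      \<open>L\<close> times its length is at most \<open>\<eta> / 2\<close>, as fact
      \<open>4\<close> requires.\<close>
    define s where "s = Min {\<delta> / 2, \<rho> / 2, \<eta> / (2 * L)} / norm e"
    have s: "s > 0" using \<delta> rho eta e L_pos by (simp add: s_def)
    have se: "s * norm e = Min {\<delta> / 2, \<rho> / 2, \<eta> / (2 * L)}" using e by (simp add: s_def)
    have "s * norm e \<le> \<eta> / (2 * L)" unfolding se by simp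
    then have sL: "L * (s * norm e) \<le> \<eta> / 2" using L_pos by (simp add: field_simps)
    have sd: "s * norm e < \<delta>" "s * norm e < \<rho>" unfolding se using \<delta>(1) rho by (auto simp: min_less_iff_disj)
    define v where "v = u - s *\<^sub>R e"
    have vu: "v - u = - (s *\<^sub>R e)" by (simp add: v_def)
    have nv: "norm (v - u) = s * norm e" using s by (simp add: vu)
    have 1: "inner z (v - u) - inner d (F v - F u) \<le> \<eta> / 2 * norm (v - u)"
      using \<delta>(2)[of v] sd nv by linarith
    have 2: "- K * norm (v - u) \<le> (inner (F v) (v - ub) - 2 * f v) - (inner (F u) (u - ub) - 2 * f u)"
      using K[of v] sd nv by auto
    have 3: "2 * inner (F u) (v - u) \<le> 2 * (f v - f u)"
      using lower[of u v] mu_pos by (smt (verit) mult_nonneg_nonneg half_gt_zero zero_le_power2)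
    have 4: "inner (F v - F u) (v - u) \<le> \<eta> / 2 * norm (v - u)"
    proof -
      have "inner (F v - F u) (v - u) \<le> norm (F v - F u) * norm (v - u)" by (rule norm_cauchy_schwarz)
      also have "\<dots> \<le> (L * norm (v - u)) * norm (v - u)" using lip by (intro mult_right_mono) auto
      also have "\<dots> \<le> \<eta> / 2 * norm (v - u)" using sL unfolding nv[symmetric] by (intro mult_right_mono) auto
      finally show ?thesis .
    qed
    have 5: "\<mu> * (norm (v - u))\<^sup>2 \<le> inner (F v - F u) (v - u)" by (rule strongly_monotone)
    have 6: "inner (F v - F u) (v - u) = - s * inner e (F v - F u)"
      by (simp add: vu inner_commute)
    have "inner e (F v - F u) = inner d (F v - F u) + inner (u - ub) (F v - F u)"
      by (simp add: e_def inner_diff_left inner_add_left)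
    \<comment> \<open>Product rule for the pairing of \<open>F v\<close> with \<open>v - ub\<close>;
      facts \<open>2\<close>, \<open>3\<close> and \<open>4\<close> estimate the right-hand side
      from below.\<close>
    also have "inner (u - ub) (F v - F u) = (inner (F v) (v - ub) - inner (F u) (u - ub))
        - inner (F u) (v - u) - inner (F v - F u) (v - u)"
      by (simp add: inner_diff_left inner_diff_right inner_commute)
    finally have "inner (z + F u) (v - u) - (K + \<eta>) * norm (v - u) \<le> inner e (F v - F u)"
      using 1 2 3 4 unfolding inner_add_left by (simp add: algebra_simps)
    then have "- inner e (F v - F u) \<le> norm (z + F u) * norm (v - u) + (K + \<eta>) * norm (v - u)"
      using Cauchy_Schwarz_ineq2[of "z + F u" "v - u"] by linarith
    then have "s * - inner e (F v - F u) \<le> s * ((norm (z + F u) + K + \<eta>) * norm (v - u))"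
      using s by (intro mult_left_mono) (auto simp: algebra_simps)
    then have "\<mu> * (s * norm e)\<^sup>2 \<le> s * ((norm (z + F u) + K + \<eta>) * (s * norm e))"
      using 5 6 nv by simp
    then have "(s * s * norm e) * (\<mu> * norm e) \<le> (s * s * norm e) * (norm (z + F u) + K + \<eta>)"
      by (simp add: power2_eq_square algebra_simps)
    moreover have "s * s * norm e > 0" using s e by simp
    ultimately show "\<mu> * norm (u + d - ub) \<le> norm (z + F u) + K + \<eta>"
      unfolding e_def[symmetric] by (simp only: mult_le_cancel_left_pos)
  qed
qed

text \<open>\<open>newton_point_bound\<close> is applied, with the constant of
  \<open>euler_defect_lipschitz\<close>, to regular values approximating \<open>- F u\<close>, whose
  residuals vanish in the limit. Scaling \<open>\<epsilon>\<close> by \<open>\<mu>\<close> absorbs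
  the modulus.\<close>

lemma newton_point_superlinear:
  assumes zero: "F ub = 0" and semi: "semismooth_at F ub" and eps: "\<epsilon> > 0"
  shows "\<exists>\<delta>>0. \<forall>u d. norm (u - ub) < \<delta> \<longrightarrow> - F u \<in> lim_coderiv F u d \<longrightarrow>
      norm (u + d - ub) \<le> \<epsilon> * norm (u - ub)"
proof -
  have em: "\<epsilon> * \<mu> > 0" using eps mu_pos by simp
  then obtain \<delta> where \<delta>: "\<delta> > 0" "\<And>u d z. norm (u - ub) < \<delta> \<Longrightarrow> z \<in> reg_coderiv F u d \<Longrightarrow>
        \<bar>inner z (u - ub) - inner d (F u - F ub)\<bar> \<le> \<epsilon> * \<mu> * norm (u - ub) * norm d"
    using semi unfolding semismooth_at_def by meson
  have "norm (u + d - ub) \<le> \<epsilon> * norm (u - ub)"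
    if u: "norm (u - ub) < \<delta>" and d: "- F u \<in> lim_coderiv F u d" for u d
  proof -
    obtain us ds zs where *: "\<And>k. zs k \<in> reg_coderiv F (us k) (ds k)" "us \<longlonglongrightarrow> u" "ds \<longlonglongrightarrow> d" "zs \<longlonglongrightarrow> - F u"
      using d unfolding lim_coderiv_def by blast
    have bound: "\<mu> * norm (us k + ds k - ub) \<le> norm (zs k + F (us k)) + \<epsilon> * \<mu> * r"
      if r: "norm (us k - ub) < r" "r < \<delta>" for k r
    proof (rule newton_point_bound[OF *(1)])
      show "r - norm (us k - ub) > 0" using r by simp
      fix v assume "norm (v - us k) < r - norm (us k - ub)"
      then have "norm (v - ub) \<le> r"
        using norm_triangle_ineq[of "v - us k" "us k - ub"] by simp
      then show "\<bar>(inner (F v) (v - ub) - 2 * f v) - (inner (F (us k)) (us k - ub) - 2 * f (us k))\<bar>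
          \<le> \<epsilon> * \<mu> * r * norm (v - us k)"
        by (intro euler_defect_lipschitz[OF zero em \<delta>(2)]) (use r in auto)
    qed
    have lim_us: "(\<lambda>k. norm (us k - ub)) \<longlonglongrightarrow> norm (u - ub)" by (intro tendsto_intros *)
    have limF: "(\<lambda>k. F (us k)) \<longlonglongrightarrow> F u"
      by (rule continuous_on_tendsto_compose[OF continuous_grad[of UNIV] *(2)]) auto
    have "\<mu> * norm (u + d - ub) \<le> \<epsilon> * \<mu> * r" if r: "norm (u - ub) < r" "r < \<delta>" for r
    proof -
      have "(\<lambda>k. \<mu> * norm (us k + ds k - ub)) \<longlonglongrightarrow> \<mu> * norm (u + d - ub)" by (intro tendsto_intros *)
      moreover have "(\<lambda>k. norm (zs k + F (us k)) + \<epsilon> * \<mu> * r) \<longlonglongrightarrow> norm (- F u + F u) + \<epsilon> * \<mu> * r"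
        by (intro tendsto_intros * limF)
      moreover have "\<forall>\<^sub>F k in sequentially. \<mu> * norm (us k + ds k - ub) \<le> norm (zs k + F (us k)) + \<epsilon> * \<mu> * r"
        using order_tendstoD(2)[OF lim_us r(1)] by eventually_elim (use bound r in blast)
      ultimately show ?thesis
        using tendsto_le[OF trivial_limit_sequentially] by fastforce
    qed
    \<comment> \<open>A radius strictly above \<open>norm (u - ub)\<close> left room for a
      neighbourhood of \<open>us k\<close> in the ball; now it decreases to
      \<open>norm (u - ub)\<close>.\<close>
    then have "norm (u + d - ub) / \<epsilon> \<le> r" if "norm (u - ub) < r" "r < \<delta>" for r
      using that mu_pos eps by (force simp: field_simps)
    then have "norm (u + d - ub) / \<epsilon> \<le> norm (u - ub)"
      using u by (metis dense_ge_bounded)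
    then show ?thesis using eps by (simp add: field_simps)
  qed
  with \<delta>(1) show ?thesis by blast
qed

text \<open>Up to small multiples of the squared distance, \<open>f u - f ub\<close> is at least
  half the pairing of \<open>F u\<close> with \<open>u - ub\<close>, \<open>f (u + d) - f ub\<close>
  is at most zero, and \<open>- inner (F u) d\<close> is at most that pairing. The surplus share
  \<open>1/2 - \<sigma>\<close> of the pairing pays for the errors.\<close>

lemma unit_step_accepted:
  assumes zero: "F ub = 0" and semi: "semismooth_at F ub" and sigma: "0 < \<sigma>" "\<sigma> < 1/2"
  shows "\<exists>\<delta>>0. \<forall>u d. norm (u - ub) < \<delta> \<longrightarrow> - F u \<in> lim_coderiv F u d \<longrightarrow>
      f (u + d) \<le> f u + \<sigma> * inner (F u) d"
proof -
  \<comment> \<open>The surplus is at least \<open>c\<close> times the squared distance;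
    \<open>\<epsilon>\<close> and the tolerance \<open>c / 2\<close> make each of the three errors
    at most a quarter of that.\<close>
  define c where "c = (1/2 - \<sigma>) * \<mu>"
  have c: "c > 0" using sigma mu_pos by (simp add: c_def)
  define \<epsilon> where "\<epsilon> = Min {1, c / (2 * L)}"
  have eps: "\<epsilon> > 0" "\<epsilon> \<le> 1" "\<epsilon> \<le> c / (2 * L)" using c L_pos by (auto simp: \<epsilon>_def)
  obtain \<delta>1 where \<delta>1: "\<delta>1 > 0" "\<And>u d. norm (u - ub) < \<delta>1 \<Longrightarrow> - F u \<in> lim_coderiv F u d \<Longrightarrow>
      norm (u + d - ub) \<le> \<epsilon> * norm (u - ub)"
    using newton_point_superlinear[OF zero semi eps(1)] by blast
  obtain \<delta>2 where \<delta>2: "\<delta>2 > 0" "\<And>u d z. norm (u - ub) < \<delta>2 \<Longrightarrow> z \<in> reg_coderiv F u d \<Longrightarrow>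
        \<bar>inner z (u - ub) - inner d (F u - F ub)\<bar> \<le> c / 2 * norm (u - ub) * norm d"
    using semi c unfolding semismooth_at_def by (meson half_gt_zero)
  have "f (u + d) \<le> f u + \<sigma> * inner (F u) d"
    if u: "norm (u - ub) < Min {\<delta>1, \<delta>2}" and d: "- F u \<in> lim_coderiv F u d" for u d
  proof -
    define r where "r = norm (u - ub)"
    have r0: "r \<ge> 0" by (simp add: r_def)
    have e: "norm (u + d - ub) \<le> \<epsilon> * r" using \<delta>1(2)[OF _ d] u by (simp add: r_def)
    have "\<bar>(inner (F u) (u - ub) - 2 * f u) - (inner (F ub) (ub - ub) - 2 * f ub)\<bar> \<le> c / 2 * r * norm (u - ub)"
      using u c by (intro euler_defect_lipschitz[where \<delta>=\<delta>2, OF zero _ \<delta>2(2)]) (auto simp: r_def)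
    then have p: "inner (F u) (u - ub) \<le> 2 * (f u - f ub) + c / 2 * r\<^sup>2"
      unfolding r_def power2_eq_square inner_diff_right[of _ ub ub] by (simp only: abs_le_iff) argo
    have m: "\<mu> * r\<^sup>2 \<le> inner (F u) (u - ub)" using strongly_monotone[of u ub] by (simp add: zero r_def)
    have "f (u + d) \<le> f ub + L / 2 * (norm (u + d - ub))\<^sup>2" using upper[of "u + d" ub] by (simp add: zero)
    also have "\<dots> \<le> f ub + L / 2 * (\<epsilon> * r)\<^sup>2"
      using e L_pos by (intro add_left_mono mult_left_mono power_mono) auto
    also have "\<dots> = f ub + L / 2 * \<epsilon> * \<epsilon> * r\<^sup>2" by (simp add: power2_eq_square)
    also have "\<dots> \<le> f ub + L / 2 * (c / (2 * L)) * 1 * r\<^sup>2"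
      using eps L_pos c by (intro add_left_mono mult_right_mono mult_mono) auto
    also have "\<dots> = f ub + c / 4 * r\<^sup>2" using L_pos by simp
    finally have 1: "f (u + d) \<le> f ub + c / 4 * r\<^sup>2" .
    have "- inner (F u) (u + d - ub) \<le> norm (F u) * norm (u + d - ub)"
      using Cauchy_Schwarz_ineq2[of "F u" "u + d - ub"] by linarith
    also have "\<dots> \<le> (L * r) * (\<epsilon> * r)"
      using lip[of u ub] e L_pos r0 by (intro mult_mono) (auto simp: zero r_def)
    also have "\<dots> = \<epsilon> * L * r\<^sup>2" by (simp add: power2_eq_square)
    also have "\<dots> \<le> c / (2 * L) * L * r\<^sup>2" using eps L_pos by (intro mult_right_mono) auto
    also have "\<dots> = c / 2 * r\<^sup>2" using L_pos by simp
    finally have 2: "- inner (F u) d \<le> inner (F u) (u - ub) + c / 2 * r\<^sup>2"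
      by (simp add: inner_diff_right inner_add_right)
    have "\<sigma> * - inner (F u) d \<le> \<sigma> * (inner (F u) (u - ub) + c / 2 * r\<^sup>2)"
      using 2 sigma by (intro mult_left_mono) auto
    also have "\<dots> \<le> \<sigma> * inner (F u) (u - ub) + 1/2 * (c / 2 * r\<^sup>2)"
      using mult_right_mono[of \<sigma> "1/2" "c / 2 * r\<^sup>2"] sigma c by (simp add: distrib_left)
    finally have 3: "\<sigma> * - inner (F u) d \<le> \<sigma> * inner (F u) (u - ub) + c / 4 * r\<^sup>2" by simp
    have "c * r\<^sup>2 \<le> (1/2 - \<sigma>) * inner (F u) (u - ub)"
      using mult_left_mono[OF m, of "1/2 - \<sigma>"] sigma by (simp add: c_def mult.assoc)
    then have 4: "c * r\<^sup>2 + \<sigma> * inner (F u) (u - ub) \<le> f u - f ub + c / 4 * r\<^sup>2"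
      using p by (simp add: algebra_simps)
    have "0 \<le> c * r\<^sup>2" using c by simp
    then show ?thesis using 1 3 4 by argo
  qed
  moreover have "Min {\<delta>1, \<delta>2} > 0" using \<delta>1 \<delta>2 by simp
  ultimately show ?thesis by blast
qed

text \<open>Strong convexity bounds the sublevel set of \<open>f 0\<close>, so a minimizer exists; a
  gradient step of factor \<open>1 / L\<close> from it would lower \<open>f\<close> by at least
  \<open>(norm (F v))\<^sup>2 / (2 * L)\<close>.\<close>

lemma ex_zero_grad: "\<exists>ub. F ub = 0"
proof -
  define R where "R = 2 * norm (F 0) / \<mu>"
  have R: "R \<ge> 0" using mu_pos by (simp add: R_def)
  have near: "norm v \<le> R" if "f v \<le> f 0" for v
  proof -
    have "\<mu> / 2 * (norm v)\<^sup>2 \<le> - inner (F 0) v" using lower[of 0 v] that by simp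
    also have "\<dots> \<le> norm (F 0) * norm v" using Cauchy_Schwarz_ineq2[of "F 0" v] by linarith
    finally have "(\<mu> / 2 * norm v) * norm v \<le> norm (F 0) * norm v" by (simp add: power2_eq_square)
    then have "\<mu> / 2 * norm v \<le> norm (F 0)" by (cases "v = 0") auto
    then show ?thesis using mu_pos by (simp add: R_def field_simps)
  qed
  have "continuous_on (cball 0 R) f"
    by (intro continuous_at_imp_continuous_on ballI has_derivative_continuous[OF has_derivative_f])
  then obtain v where v: "v \<in> cball 0 R" "\<And>w. w \<in> cball 0 R \<Longrightarrow> f v \<le> f w"
    using continuous_attains_inf[of "cball 0 R" f] R by auto
  have "f v \<le> f 0" using v(2)[of 0] R by simp
  then have min: "f v \<le> f w" for w
    using near[of w] v(2)[of w] by (cases "f w \<le> f 0") auto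
  have "f v \<le> f v + inner (F v) (- (F v /\<^sub>R L)) + L / 2 * (norm (F v /\<^sub>R L))\<^sup>2"
    using order_trans[OF min[of "v - F v /\<^sub>R L"] upper[of "v - F v /\<^sub>R L" v]] by simp
  also have "\<dots> = f v - (norm (F v))\<^sup>2 / (2 * L)"
    using L_pos by (simp add: power2_norm_eq_inner[symmetric] power_mult_distrib power2_eq_square field_simps)
  finally have "(norm (F v))\<^sup>2 \<le> 0" using L_pos by (simp add: divide_le_0_iff)
  then show ?thesis by auto
qed

text \<open>The quadratic term of the upper bound is absorbed by the share
  \<open>1 - \<sigma>\<close> of the slope, which is at least
  \<open>\<mu> * (norm d)\<^sup>2\<close> in size. The threshold depends neither on \<open>u\<close>
  nor on \<open>d\<close>.\<close>

lemma armijo_small_step: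
  assumes d: "- F u \<in> lim_coderiv F u d" and sigma: "\<sigma> < 1"
    and \<tau>: "0 \<le> \<tau>" "\<tau> \<le> 2 * (1 - \<sigma>) * \<mu> / L"
  shows "f (u + \<tau> *\<^sub>R d) \<le> f u + \<sigma> * \<tau> * inner (F u) d"
proof -
  have a: "\<mu> * (norm d)\<^sup>2 \<le> - inner (F u) d" using lim_coderiv_bounds(1)[OF d] by simp
  have "\<tau> * L / 2 \<le> (1 - \<sigma>) * \<mu>" using \<tau> L_pos by (simp add: field_simps)
  then have "(\<tau> * L / 2) * (\<tau> * (norm d)\<^sup>2) \<le> ((1 - \<sigma>) * \<mu>) * (\<tau> * (norm d)\<^sup>2)"
    using \<tau> by (intro mult_right_mono) auto
  also have "\<dots> = ((1 - \<sigma>) * \<tau>) * (\<mu> * (norm d)\<^sup>2)" by simp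
  also have "\<dots> \<le> ((1 - \<sigma>) * \<tau>) * - inner (F u) d"
    using a sigma \<tau> by (intro mult_left_mono) auto
  finally show ?thesis
    using upper[of "u + \<tau> *\<^sub>R d" u] by (simp add: power2_eq_square algebra_simps)
qed

text \<open>Counterpart of \<open>gdna_step\<close> with the direction inclusion stated through
  \<open>F\<close>; \<open>dir_ok_iff\<close> makes the two coincide.\<close>

definition newton_step :: "real \<Rightarrow> real \<Rightarrow> 'a \<Rightarrow> 'a \<Rightarrow> bool" where
  "newton_step \<sigma> \<beta> u u' \<longleftrightarrow> (if F u = 0 then u' = u else
     \<exists>d. - F u \<in> lim_coderiv F u d \<and>
       u' = u + (\<beta> ^ (LEAST j. f (u + \<beta> ^ j *\<^sub>R d) \<le> f u + \<sigma> * \<beta> ^ j * inner (F u) d)) *\<^sub>R d)"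

section \<open>Convergence of the damped Newton iteration\<close>

context
  fixes \<sigma> \<beta> :: real
  assumes sigma: "0 < \<sigma>" "\<sigma> < 1/2" and beta: "0 < \<beta>" "\<beta> < 1"
begin

lemma ex_armijo:
  assumes "- F u \<in> lim_coderiv F u d"
  shows "\<exists>j. f (u + \<beta> ^ j *\<^sub>R d) \<le> f u + \<sigma> * \<beta> ^ j * inner (F u) d"
proof -
  have "2 * (1 - \<sigma>) * \<mu> / L > 0" using sigma mu_pos L_pos by simp
  then obtain j where "\<beta> ^ j < 2 * (1 - \<sigma>) * \<mu> / L" using real_arch_pow_inv beta by blast
  then show ?thesis using armijo_small_step[OF assms, of \<sigma> "\<beta> ^ j"] sigma beta by (intro exI[of _ j]) simp
qed

text \<open>Backtracking either accepts \<open>1\<close> or has rejected the previous step length,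
  which therefore exceeds the threshold of \<open>armijo_small_step\<close>; one factor
  \<open>\<beta>\<close> is lost.\<close>

lemma armijo_LEAST:
  fixes u d
  assumes d: "- F u \<in> lim_coderiv F u d"
  defines "\<tau> \<equiv> \<beta> ^ (LEAST j. f (u + \<beta> ^ j *\<^sub>R d) \<le> f u + \<sigma> * \<beta> ^ j * inner (F u) d)"
  shows "f (u + \<tau> *\<^sub>R d) \<le> f u + \<sigma> * \<tau> * inner (F u) d"
    and "min 1 (\<beta> * (2 * (1 - \<sigma>) * \<mu> / L)) \<le> \<tau>"
proof -
  define ok where "ok j \<longleftrightarrow> f (u + \<beta> ^ j *\<^sub>R d) \<le> f u + \<sigma> * \<beta> ^ j * inner (F u) d" for j
  have \<tau>: "\<tau> = \<beta> ^ (LEAST j. ok j)" by (simp add: \<tau>_def ok_def)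
  have "ok (LEAST j. ok j)" using ex_armijo[OF d] unfolding ok_def[symmetric] by (rule LeastI_ex)
  then show "f (u + \<tau> *\<^sub>R d) \<le> f u + \<sigma> * \<tau> * inner (F u) d" by (simp add: ok_def \<tau>)
  show "min 1 (\<beta> * (2 * (1 - \<sigma>) * \<mu> / L)) \<le> \<tau>"
  proof (cases "LEAST j. ok j")
    case (Suc i)
    then have "\<not> ok i" using not_less_Least[of i ok] by simp
    then have "2 * (1 - \<sigma>) * \<mu> / L \<le> \<beta> ^ i"
      using armijo_small_step[OF d, of \<sigma> "\<beta> ^ i"] sigma beta unfolding ok_def by fastforce
    then have "\<beta> * (2 * (1 - \<sigma>) * \<mu> / L) \<le> \<tau>" using beta by (simp add: \<tau> Suc del: times_divide_eq_right)
    then show ?thesis by simp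
  qed (simp add: \<tau>)
qed

lemma ex_newton_step: "\<exists>u'. newton_step \<sigma> \<beta> u u'"
  using ex_lim_coderiv[of "- F u" u] by (cases "F u = 0") (auto simp: newton_step_def)

text \<open>An accepted step lowers \<open>f\<close> by a multiple of
  \<open>(norm d)\<^sup>2\<close>, which dominates \<open>(norm (F u))\<^sup>2\<close> and thereby
  the gap \<open>f u - f ub\<close>. The factor is uniform because step lengths are bounded
  below.\<close>

lemma newton_step_decrease:
  assumes zero: "F ub = 0"
  obtains \<theta> where "0 < \<theta>" "\<theta> < 1" "\<And>u u'. newton_step \<sigma> \<beta> u u' \<Longrightarrow> f u' - f ub \<le> \<theta> * (f u - f ub)"
proof -
  define \<tau>0 where "\<tau>0 = min 1 (\<beta> * (2 * (1 - \<sigma>) * \<mu> / L))"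
  have \<tau>0: "\<tau>0 > 0" using beta sigma mu_pos L_pos by (simp add: \<tau>0_def)
  \<comment> \<open>The minimum with \<open>1/2\<close> keeps the factor \<open>1 - \<rho>\<close>
    positive.\<close>
  define \<rho> where "\<rho> = min (1/2) (\<sigma> * \<tau>0 * \<mu> * (\<mu> / L\<^sup>2))"
  have rho: "0 < \<rho>" "\<rho> \<le> 1/2" "\<rho> \<le> \<sigma> * \<tau>0 * \<mu> * (\<mu> / L\<^sup>2)"
    unfolding \<rho>_def using \<tau>0 sigma mu_pos L_pos by (simp, linarith, linarith)
  have "f u' - f ub \<le> (1 - \<rho>) * (f u - f ub)" if step: "newton_step \<sigma> \<beta> u u'" for u u'
  proof -
    have grow: "f u - f ub \<le> (norm (F u))\<^sup>2 / \<mu>"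
    proof -
      have "f u - f ub \<le> inner (F u) (u - ub)"
        using lower[of u ub] mu_pos unfolding inner_diff_right
        by (smt (verit) mult_nonneg_nonneg half_gt_zero zero_le_power2)
      also have "\<dots> \<le> norm (F u) * norm (u - ub)" by (rule norm_cauchy_schwarz)
      also have "\<dots> \<le> norm (F u) * (norm (F u) / \<mu>)"
        using norm_grad_diff_ge[of u ub] mu_pos by (intro mult_left_mono) (auto simp: zero field_simps)
      finally show ?thesis by (simp add: power2_eq_square)
    qed
    show ?thesis
    proof (cases "F u = 0")
      case True
      then have "u' = u" "f u \<le> f ub" using step grow by (auto simp: newton_step_def)
      then show ?thesis using mult_nonneg_nonpos[of \<rho> "f u - f ub"] rho by (simp add: algebra_simps)
    next
      case False
      then obtain d where d: "- F u \<in> lim_coderiv F u d" and u': "u' = u +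
          (\<beta> ^ (LEAST j. f (u + \<beta> ^ j *\<^sub>R d) \<le> f u + \<sigma> * \<beta> ^ j * inner (F u) d)) *\<^sub>R d"
        using step by (auto simp: newton_step_def)
      define \<tau> where "\<tau> = \<beta> ^ (LEAST j. f (u + \<beta> ^ j *\<^sub>R d) \<le> f u + \<sigma> * \<beta> ^ j * inner (F u) d)"
      have a: "f u' \<le> f u + \<sigma> * \<tau> * inner (F u) d" "\<tau>0 \<le> \<tau>"
        using armijo_LEAST[OF d] by (auto simp: u' \<tau>_def \<tau>0_def)
      have "\<rho> * (f u - f ub) \<le> \<sigma> * \<tau>0 * \<mu> * (norm d)\<^sup>2"
      proof (cases "f u \<le> f ub")
        case True
        then have "\<rho> * (f u - f ub) \<le> 0" using rho by (intro mult_nonneg_nonpos) auto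
        also have "0 \<le> \<sigma> * \<tau>0 * \<mu> * (norm d)\<^sup>2" using sigma \<tau>0 mu_pos by simp
        finally show ?thesis .
      next
        case False
        then have "\<rho> * (f u - f ub) \<le> (\<sigma> * \<tau>0 * \<mu> * (\<mu> / L\<^sup>2)) * ((norm (F u))\<^sup>2 / \<mu>)"
          using rho grow by (intro mult_mono) auto
        also have "\<dots> = \<sigma> * \<tau>0 * \<mu> * ((norm (F u))\<^sup>2 / L\<^sup>2)" using mu_pos by simp
        also have "(norm (F u))\<^sup>2 \<le> (L * norm d)\<^sup>2"
          using lim_coderiv_bounds(2)[OF d] by (intro power_mono) auto
        then have "(norm (F u))\<^sup>2 / L\<^sup>2 \<le> (norm d)\<^sup>2" using L_pos by (simp add: field_simps)
        then have "\<sigma> * \<tau>0 * \<mu> * ((norm (F u))\<^sup>2 / L\<^sup>2) \<le> \<sigma> * \<tau>0 * \<mu> * (norm d)\<^sup>2"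
          using sigma \<tau>0 mu_pos by (intro mult_left_mono) auto
        finally show ?thesis .
      qed
      also have "\<dots> \<le> \<sigma> * \<tau> * (\<mu> * (norm d)\<^sup>2)"
        using a(2) sigma mu_pos by (simp add: mult.assoc mult_right_mono)
      also have "\<dots> \<le> \<sigma> * \<tau> * - inner (F u) d"
        using lim_coderiv_bounds(1)[OF d] sigma a(2) \<tau>0 by (intro mult_left_mono) auto
      finally show ?thesis using a(1) by (simp add: algebra_simps)
    qed
  qed
  then show thesis using that[of "1 - \<rho>"] rho by auto
qed

text \<open>The gap in values decays geometrically and bounds the squared distance by strong
  convexity, hence the rate \<open>sqrt \<theta>\<close>.\<close>

lemma newton_R_linear:
  assumes zero: "F ub = 0" and step: "\<And>k. newton_step \<sigma> \<beta> (u k) (u (Suc k))"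
  shows "R_linear_conv u ub"
proof -
  obtain \<theta> where \<theta>: "0 < \<theta>" "\<theta> < 1"
    "\<And>u u'. newton_step \<sigma> \<beta> u u' \<Longrightarrow> f u' - f ub \<le> \<theta> * (f u - f ub)"
    using newton_step_decrease[OF zero] by blast
  have dec: "f (u k) - f ub \<le> \<theta> ^ k * (f (u 0) - f ub)" for k
  proof (induction k)
    case (Suc k)
    have "f (u (Suc k)) - f ub \<le> \<theta> * (f (u k) - f ub)" by (rule \<theta>(3)[OF step])
    also have "\<dots> \<le> \<theta> * (\<theta> ^ k * (f (u 0) - f ub))" using Suc \<theta> by (intro mult_left_mono) auto
    finally show ?case by simp
  qed simp
  define C where "C = sqrt (2 * (f (u 0) - f ub) / \<mu>)"
  have "norm (u k - ub) \<le> C * sqrt \<theta> ^ k" for k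
  proof -
    have "\<mu> / 2 * (norm (u k - ub))\<^sup>2 \<le> f (u k) - f ub" using lower[of ub "u k"] by (simp add: zero)
    also have "\<dots> \<le> \<theta> ^ k * (f (u 0) - f ub)" by (rule dec)
    finally have "(norm (u k - ub))\<^sup>2 \<le> 2 * (f (u 0) - f ub) / \<mu> * \<theta> ^ k"
      using mu_pos by (simp add: field_simps)
    then have "norm (u k - ub) \<le> sqrt (2 * (f (u 0) - f ub) / \<mu> * \<theta> ^ k)" by (rule real_le_rsqrt)
    also have "\<dots> = C * sqrt \<theta> ^ k" by (simp only: C_def real_sqrt_mult real_sqrt_power)
    finally show ?thesis .
  qed
  \<comment> \<open>\<open>C\<close> may be zero, whereas \<open>R_linear_conv\<close> asks for a
    positive constant.\<close>
  moreover have "C * sqrt \<theta> ^ k \<le> (\<bar>C\<bar> + 1) * sqrt \<theta> ^ k" for k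
    using \<theta> by (intro mult_right_mono) auto
  ultimately have "\<forall>k. norm (u k - ub) \<le> (\<bar>C\<bar> + 1) * sqrt \<theta> ^ k" using order_trans by blast
  then show ?thesis unfolding R_linear_conv_def
    using \<theta> by (intro exI[of _ "\<bar>C\<bar> + 1"] conjI exI[of _ "sqrt \<theta>"]) auto
qed

text \<open>Near \<open>ub\<close> the full step passes the line search, so the next iterate is the
  Newton point and obeys the superlinear estimate.\<close>

lemma newton_Q_superlinear:
  assumes zero: "F ub = 0" and semi: "semismooth_at F ub"
    and step: "\<And>k. newton_step \<sigma> \<beta> (u k) (u (Suc k))" and conv: "u \<longlonglongrightarrow> ub"
  shows "Q_superlinear_conv u ub"
  unfolding Q_superlinear_conv_def
proof (rule tendstoI)
  fix \<epsilon> :: real assume "\<epsilon> > 0"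
  then have e2: "\<epsilon> / 2 > 0" by simp
  obtain \<delta>1 where \<delta>1: "\<delta>1 > 0" "\<And>u d. norm (u - ub) < \<delta>1 \<Longrightarrow> - F u \<in> lim_coderiv F u d \<Longrightarrow>
      norm (u + d - ub) \<le> \<epsilon> / 2 * norm (u - ub)"
    using newton_point_superlinear[OF zero semi e2] by blast
  obtain \<delta>2 where \<delta>2: "\<delta>2 > 0" "\<And>u d. norm (u - ub) < \<delta>2 \<Longrightarrow> - F u \<in> lim_coderiv F u d \<Longrightarrow>
      f (u + d) \<le> f u + \<sigma> * inner (F u) d"
    using unit_step_accepted[OF zero semi sigma] by blast
  have "\<forall>\<^sub>F k in sequentially. norm (u k - ub) < min \<delta>1 \<delta>2"
    using tendstoD[OF conv, of "min \<delta>1 \<delta>2"] \<delta>1 \<delta>2 by (simp add: dist_norm)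
  then show "\<forall>\<^sub>F k in sequentially. dist (norm (u (Suc k) - ub) / norm (u k - ub)) 0 < \<epsilon>"
  proof eventually_elim
    case (elim k)
    show ?case
    proof (cases "F (u k) = 0")
      \<comment> \<open>A stopped sequence sits at \<open>ub\<close>, where the quotient
        \<open>0 / 0\<close> is \<open>0\<close>.\<close>
      case True
      then have "u (Suc k) = u k" using step[of k] by (simp add: newton_step_def)
      moreover have "u k = ub" using norm_grad_diff_ge[of "u k" ub] mu_pos True zero
        by (simp add: mult_le_0_iff)
      ultimately show ?thesis using \<open>\<epsilon> > 0\<close> by simp
    next
      case False
      then obtain d where d: "- F (u k) \<in> lim_coderiv F (u k) d" and u': "u (Suc k) = u k +
          (\<beta> ^ (LEAST j. f (u k + \<beta> ^ j *\<^sub>R d) \<le> f (u k) + \<sigma> * \<beta> ^ j * inner (F (u k)) d)) *\<^sub>R d"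
        using step[of k] by (auto simp: newton_step_def)
      have "(LEAST j. f (u k + \<beta> ^ j *\<^sub>R d) \<le> f (u k) + \<sigma> * \<beta> ^ j * inner (F (u k)) d) = 0"
        using \<delta>2(2)[OF _ d] elim by (intro Least_eq_0) simp
      then have "u (Suc k) = u k + d" by (simp add: u')
      then have "norm (u (Suc k) - ub) \<le> \<epsilon> / 2 * norm (u k - ub)"
        using \<delta>1(2)[OF _ d] elim by simp
      moreover have "norm (u k - ub) > 0" using False zero by auto
      ultimately have "norm (u (Suc k) - ub) / norm (u k - ub) \<le> \<epsilon> / 2" by (simp add: divide_le_eq)
      also have "\<epsilon> / 2 < \<epsilon>" using \<open>\<epsilon> > 0\<close> by simp
      finally show ?thesis by simp
    qed
  qed
qed

end

end

lemma R_linear_conv_imp_tendsto: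
  assumes "R_linear_conv u ub" shows "u \<longlonglongrightarrow> ub"
proof -
  obtain C \<mu> where *: "0 < \<mu>" "\<mu> < 1" "\<forall>\<^sub>F k in sequentially. norm (u k - ub) \<le> C * \<mu> ^ k"
    using assms unfolding R_linear_conv_def by blast
  have "(\<lambda>k. C * \<mu> ^ k) \<longlonglongrightarrow> 0"
    using * by (intro tendsto_mult_right_zero LIMSEQ_power_zero) auto
  then have "(\<lambda>k. u k - ub) \<longlonglongrightarrow> 0" using *(3) by (rule Lim_null_comparison[rotated])
  then show ?thesis by (simp add: LIM_zero_iff)
qed

section \<open>The proximal map of a convex function\<close>

text \<open>This form suits covering arguments; \<open>nhds\<close> includes \<open>x\<close>
  itself, where the inequality holds anyway.\<close>

definition lsc_at :: "('a::topological_space \<Rightarrow> ereal) \<Rightarrow> 'a \<Rightarrow> bool" where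
  "lsc_at h x \<longleftrightarrow> (\<forall>c < h x. \<forall>\<^sub>F y in nhds x. c < h y)"

lemma lsc_fun_iff_lsc_at: "lsc_fun h \<longleftrightarrow> (\<forall>x. lsc_at h x)"
  unfolding lsc_fun_def lsc_at_def le_Liminf_iff
  by (auto simp: eventually_nhds_conv_at)

lemma lsc_at_add_continuous:
  fixes q :: "'a::t2_space \<Rightarrow> real"
  assumes "lsc_at g x" "isCont q x"
  shows "lsc_at (\<lambda>y. g y + ereal (q y)) x"
  unfolding lsc_at_def
proof (intro allI impI)
  fix c assume c: "c < g x + ereal (q x)"
  have "c - ereal (q x) < g x" using c by (cases c; cases "g x") auto
  then obtain c' where c': "c - ereal (q x) < ereal c'" "ereal c' < g x"
    using ereal_dense2 by blast
  have "c < ereal (c' + q x)" using c' by (cases c) auto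
  then obtain a where a: "c \<le> ereal a" "a < c' + q x"
    using ereal_dense2[of c "ereal (c' + q x)"] by (metis ereal_less_eq(3) ereal_less(2) less_ereal.simps(1) less_imp_le)
  have "\<forall>\<^sub>F y in nhds x. ereal c' < g y" using assms(1) c' by (auto simp: lsc_at_def)
  moreover have "\<forall>\<^sub>F y in nhds x. a - c' < q y"
    using assms(2) a by (intro order_tendstoD(1)) (auto simp: isCont_def tendsto_at_iff_tendsto_nhds)
  ultimately show "\<forall>\<^sub>F y in nhds x. c < g y + ereal (q y)"
  proof eventually_elim
    case (elim y)
    have "c \<le> ereal a" by (rule a)
    also have "ereal a < ereal c' + ereal (q y)" using elim by simp
    also have "\<dots> \<le> g y + ereal (q y)" using elim by (intro add_right_mono) auto
    finally show ?case .
  qed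
qed

text \<open>Otherwise every \<open>x\<close> has a point \<open>Y x\<close> whose value lies
  strictly below \<open>h\<close> on a neighbourhood of \<open>x\<close>. Among the finitely many
  centres of a subcover, the least \<open>h (Y x)\<close> is undercut by the centre whose
  neighbourhood contains \<open>Y x\<close>.\<close>

lemma lsc_attains_inf:
  assumes "compact S" "S \<noteq> {}" and lsc: "\<And>x. x \<in> S \<Longrightarrow> lsc_at h x"
  shows "\<exists>x\<in>S. \<forall>y\<in>S. h x \<le> h y"
proof (rule ccontr)
  assume "\<not> ?thesis"
  then have "\<forall>x\<in>S. \<exists>y\<in>S. \<exists>U. open U \<and> x \<in> U \<and> (\<forall>z\<in>U. h y < h z)"
    using lsc unfolding lsc_at_def eventually_nhds by (metis not_le)
  then obtain Y U where Y: "\<And>x. x \<in> S \<Longrightarrow> Y x \<in> S" and U: "\<And>x. x \<in> S \<Longrightarrow> open (U x)" "\<And>x. x \<in> S \<Longrightarrow> x \<in> U x"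
      and lt: "\<And>x z. x \<in> S \<Longrightarrow> z \<in> U x \<Longrightarrow> h (Y x) < h z"
    by metis
  obtain C where C: "C \<subseteq> S" "finite C" "S \<subseteq> (\<Union>x\<in>C. U x)"
    by (rule compactE_image[OF \<open>compact S\<close>, of S U]) (use U in auto)
  then have ne: "C \<noteq> {}" using \<open>S \<noteq> {}\<close> by auto
  obtain x where x: "x \<in> C" "\<And>x'. x' \<in> C \<Longrightarrow> h (Y x) \<le> h (Y x')"
    using arg_min_if_finite[OF C(2) ne, of "\<lambda>x. h (Y x)"] by (metis not_le)
  obtain x' where "x' \<in> C" "Y x \<in> U x'" using C x(1) Y by blast
  then show False using lt[of x' "Y x"] x(2)[of x'] C(1) by (metis in_mono leD)
qed

lemma subdiff_monotone:
  assumes "y \<in> subdiff g x" "y' \<in> subdiff g x'"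
  shows "0 \<le> inner (y' - y) (x' - x)"
proof -
  obtain r r' where r: "g x = ereal r" "g x' = ereal r'"
    using assms by (auto simp: subdiff_def)
  have "g x + ereal (inner y (x' - x)) \<le> g x'" "g x' + ereal (inner y' (x - x')) \<le> g x"
    using assms by (simp_all add: subdiff_def)
  then have "r + inner y (x' - x) \<le> r'" "r' + inner y' (x - x') \<le> r" by (simp_all add: r)
  then show ?thesis by (simp add: inner_diff_left inner_diff_right)
qed

section \<open>Existence and resolvent properties of the proximal point\<close>

locale prox_setting =
  fixes g :: "'a::euclidean_space \<Rightarrow> ereal" and \<gamma> :: real
  assumes g_proper: "proper_fun g" and g_lsc: "lsc_fun g" and g_convex: "convex_fun g" and gamma_pos: "0 < \<gamma>"
begin

lemma g_not_minf: "g x \<noteq> -\<infinity>"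
  using g_proper by (auto simp: proper_fun_def)

text \<open>Convexity propagates the minimum over a unit ball to a linear lower bound, so that the
  quadratic term wins at infinity.\<close>

lemma linear_minorant:
  obtains x0 a K where "g x0 = ereal a" "K \<ge> 0" "\<And>y. ereal (a - K * (1 + norm (y - x0))) \<le> g y"
proof -
  obtain x0 a where a: "g x0 = ereal a"
    using g_proper unfolding proper_fun_def by (metis ereal_cases)
  obtain xm where xm: "xm \<in> cball x0 1" "\<And>y. y \<in> cball x0 1 \<Longrightarrow> g xm \<le> g y"
    using lsc_attains_inf[of "cball x0 1" g] g_lsc by (auto simp: lsc_fun_iff_lsc_at)
  have "g xm \<le> ereal a" using xm(2)[of x0] a by simp
  then obtain m where m: "g xm = ereal m" "m \<le> a" using g_not_minf[of xm] by (cases "g xm") auto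
  have "ereal (a - (a - m) * (1 + norm (y - x0))) \<le> g y" for y
  proof (cases "norm (y - x0) \<le> 1")
    case True
    have "(a - m) * 1 \<le> (a - m) * (1 + norm (y - x0))" using m by (intro mult_left_mono) auto
    then have "ereal (a - (a - m) * (1 + norm (y - x0))) \<le> ereal m" by simp
    also have "\<dots> \<le> g y" using xm(2)[of y] True m by (simp add: dist_norm norm_minus_commute)
    finally show ?thesis .
  next
    case False
    define R where "R = norm (y - x0)"
    have R: "R > 1" using False by (simp add: R_def)
    show ?thesis
    proof (cases "g y")
      case (real r)
      \<comment> \<open>The point of the segment from \<open>x0\<close> to \<open>y\<close> at
        distance \<open>1\<close> from \<open>x0\<close>, where the ball minimum \<open>m\<close>
        bounds \<open>g\<close> below.\<close>
      have "(1 - 1/R) *\<^sub>R x0 + (1/R) *\<^sub>R y = x0 + (1/R) *\<^sub>R (y - x0)"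
        by (simp add: algebra_simps)
      moreover have "x0 + (1/R) *\<^sub>R (y - x0) \<in> cball x0 1" using R by (simp add: dist_norm R_def)
      ultimately have "ereal m \<le> g ((1 - 1/R) *\<^sub>R x0 + (1/R) *\<^sub>R y)" using xm(2) m by simp
      also have "\<dots> \<le> ereal (1 - 1/R) * g x0 + ereal (1/R) * g y"
        using g_convex R unfolding convex_fun_def by simp
      finally have "m \<le> (1 - 1/R) * a + (1/R) * r" using a real by simp
      then have "R * m \<le> R * ((1 - 1/R) * a + (1/R) * r)" using R by (intro mult_left_mono) auto
      also have "\<dots> = (R - 1) * a + r" using R by (simp add: field_simps)
      finally show ?thesis using real m by (simp add: R_def algebra_simps)
    qed (use g_not_minf in auto)
  qed
  then show thesis using that[of x0 a "a - m"] a m by auto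
qed

text \<open>Far from \<open>x\<close> the quadratic term outweighs the linear minorant, so the
  problem reduces to a ball, where lower semicontinuity gives a minimizer.\<close>

lemma prox_set_nonempty: "prox_set \<gamma> g x \<noteq> {}"
proof -
  obtain x0 a K where *: "g x0 = ereal a" "K \<ge> 0" "\<And>y. ereal (a - K * (1 + norm (y - x0))) \<le> g y"
    using linear_minorant by blast
  define h where "h y = g y + ereal ((norm (y - x))\<^sup>2 / (2 * \<gamma>))" for y
  define B where "B = (norm (x0 - x))\<^sup>2 / (2 * \<gamma>)"
  define N where "N = norm (x - x0)"
  \<comment> \<open>\<open>N\<close> places \<open>x0\<close> in the ball; beyond the second entry
    the quadratic term exceeds the linear loss plus \<open>B\<close>, and the \<open>+ 1\<close>
    ensures distances of at least \<open>1\<close>.\<close>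
  define R where "R = max N (2 * \<gamma> * (K + K * (1 + N) + B) + 1)"
  have big: "h x0 \<le> h y" if far: "R < norm (y - x)" for y
  proof -
    define D where "D = norm (y - x)"
    have "norm (y - x0) \<le> D + N" using norm_triangle_ineq[of "y - x" "x - x0"] by (simp add: D_def N_def)
    then have "K * (1 + norm (y - x0)) \<le> K * (1 + (D + N))" using * by (intro mult_left_mono) auto
    also have "\<dots> \<le> D\<^sup>2 / (2 * \<gamma>) - B"
    proof -
      have D: "D > 2 * \<gamma> * (K + K * (1 + N) + B)" "D \<ge> 1"
      proof -
        have "0 \<le> 2 * \<gamma> * (K + K * (1 + N) + B)" using *(2) gamma_pos by (simp add: B_def N_def)
        then show "D > 2 * \<gamma> * (K + K * (1 + N) + B)" "D \<ge> 1" using far by (auto simp: D_def R_def)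
      qed
      have "2 * \<gamma> * (K * (1 + (D + N)) + B) \<le> 2 * \<gamma> * (K + K * (1 + N) + B) * D"
      proof -
        have "1 * (K * (1 + N) + B) \<le> D * (K * (1 + N) + B)"
          using D *(2) gamma_pos by (intro mult_right_mono) (auto simp: B_def N_def)
        then have "K * (1 + (D + N)) + B \<le> (K + K * (1 + N) + B) * D" by (simp add: algebra_simps)
        then have "(2 * \<gamma>) * (K * (1 + (D + N)) + B) \<le> (2 * \<gamma>) * ((K + K * (1 + N) + B) * D)"
          using gamma_pos by (intro mult_left_mono) auto
        then show ?thesis by simp
      qed
      also have "\<dots> \<le> D * D" using D by (intro mult_right_mono) auto
      finally have "(K * (1 + (D + N)) + B) \<le> D\<^sup>2 / (2 * \<gamma>)"
        using gamma_pos by (simp add: power2_eq_square field_simps)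
      then show ?thesis by simp
    qed
    finally have "ereal (a + B) \<le> ereal (a - K * (1 + norm (y - x0))) + ereal (D\<^sup>2 / (2 * \<gamma>))" by simp
    also have "\<dots> \<le> h y" unfolding h_def D_def by (intro add_right_mono *)
    finally show ?thesis by (simp add: h_def * B_def)
  qed
  have lsc: "lsc_at h y" for y
    unfolding h_def using g_lsc gamma_pos
    by (intro lsc_at_add_continuous) (auto simp: lsc_fun_iff_lsc_at intro!: continuous_intros)
  have x0: "x0 \<in> cball x R" by (simp add: R_def N_def dist_norm)
  then obtain p where p: "p \<in> cball x R" "\<And>y. y \<in> cball x R \<Longrightarrow> h p \<le> h y"
    using lsc_attains_inf[OF compact_cball _ lsc, of x R] by blast
  have "h p \<le> h y" for y
  proof (cases "y \<in> cball x R")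
    case False
    then have "h x0 \<le> h y" by (intro big) (simp add: dist_norm norm_minus_commute)
    then show ?thesis using p(2)[OF x0] order_trans by blast
  qed (rule p(2))
  then have "p \<in> prox_set \<gamma> g x" by (simp add: prox_set_def h_def)
  then show ?thesis by blast
qed

text \<open>Fermat rule: \<open>y\<close> is compared with points of the segment from
  \<open>y\<close> to \<open>z\<close>; convexity allows division by \<open>t\<close>, and the
  quadratic remainder vanishes as \<open>t\<close> tends to \<open>0\<close>.\<close>

lemma prox_set_imp_subdiff:
  assumes y: "y \<in> prox_set \<gamma> g x"
  shows "(1/\<gamma>) *\<^sub>R (x - y) \<in> subdiff g y"
proof -
  have min: "g y + ereal ((norm (y - x))\<^sup>2 / (2 * \<gamma>)) \<le> g z + ereal ((norm (z - x))\<^sup>2 / (2 * \<gamma>))" for z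
    using y by (simp add: prox_set_def)
  obtain x0 a where a: "g x0 = ereal a"
    using g_proper unfolding proper_fun_def by (metis ereal_cases)
  then obtain r where r: "g y = ereal r"
    using min[of x0] g_not_minf[of y] by (cases "g y") auto
  have "ereal (r + inner ((1/\<gamma>) *\<^sub>R (x - y)) (z - y)) \<le> g z" for z
  proof (cases "g z")
    case (real s)
    have "r + inner ((1/\<gamma>) *\<^sub>R (x - y)) (z - y) \<le> s + (norm (z - y))\<^sup>2 / (2 * \<gamma>) * t" if t: "0 < t" "t < 1" for t
    proof -
      define w where "w = (1 - t) *\<^sub>R y + t *\<^sub>R z"
      have w: "w - y = t *\<^sub>R (z - y)" by (simp add: w_def algebra_simps)
      have "g w \<le> ereal ((1 - t) * r + t * s)"
        using g_convex t r real unfolding convex_fun_def w_def by (metis plus_ereal.simps(1) times_ereal.simps(1))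
      then have "ereal (r + (norm (y - x))\<^sup>2 / (2 * \<gamma>)) \<le> ereal ((1 - t) * r + t * s) + ereal ((norm (w - x))\<^sup>2 / (2 * \<gamma>))"
        using order_trans[OF min[of w] add_right_mono] r by fastforce
      then have 1: "r + (norm (y - x))\<^sup>2 / (2 * \<gamma>) \<le> (1 - t) * r + t * s + (norm (w - x))\<^sup>2 / (2 * \<gamma>)" by simp
      have "(norm (w - x))\<^sup>2 = (norm (y - x))\<^sup>2 + 2 * inner (y - x) (w - y) + (norm (w - y))\<^sup>2"
        by (rule norm_diff_square_expand)
      also have "\<dots> = (norm (y - x))\<^sup>2 - 2 * t * inner (x - y) (z - y) + t\<^sup>2 * (norm (z - y))\<^sup>2"
        unfolding w by (simp add: power_mult_distrib inner_diff_left inner_diff_left[of x] right_diff_distrib)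
      finally have "(norm (w - x))\<^sup>2 / (2 * \<gamma>)
          = (norm (y - x))\<^sup>2 / (2 * \<gamma>) - t * (inner (x - y) (z - y) / \<gamma>) + t * ((norm (z - y))\<^sup>2 / (2 * \<gamma>) * t)"
        using gamma_pos by (simp add: add_divide_distrib diff_divide_distrib power2_eq_square)
      with 1 have "t * (r + inner (x - y) (z - y) / \<gamma>) \<le> t * (s + (norm (z - y))\<^sup>2 / (2 * \<gamma>) * t)"
        unfolding distrib_left left_diff_distrib by linarith
      then show ?thesis using t by simp
    qed
    then have "\<forall>\<^sub>F t in at_right (0::real). r + inner ((1/\<gamma>) *\<^sub>R (x - y)) (z - y) \<le> s + (norm (z - y))\<^sup>2 / (2 * \<gamma>) * t"
      using eventually_at_right_real[of 0 1] by (auto elim!: eventually_mono)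
    moreover have "((\<lambda>t. s + (norm (z - y))\<^sup>2 / (2 * \<gamma>) * t) \<longlongrightarrow> s + (norm (z - y))\<^sup>2 / (2 * \<gamma>) * 0) (at_right 0)"
      by (intro tendsto_intros)
    ultimately have "r + inner ((1/\<gamma>) *\<^sub>R (x - y)) (z - y) \<le> s"
      using tendsto_lowerbound[OF _ _ trivial_limit_at_right_real] by fastforce
    then show ?thesis using real by simp
  qed (use g_not_minf in auto)
  then show ?thesis by (simp add: subdiff_def r)
qed

lemma prox_mem: "prox \<gamma> g x \<in> prox_set \<gamma> g x"
  unfolding prox_def using prox_set_nonempty some_in_eq by blast

lemma prox_subdiff: "(1/\<gamma>) *\<^sub>R (x - prox \<gamma> g x) \<in> subdiff g (prox \<gamma> g x)"
  by (intro prox_set_imp_subdiff prox_mem)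

text \<open>Monotonicity of the subdifferential at the two proximal points, with their scaled
  residuals as subgradients.\<close>

lemma prox_firmly_nonexpansive:
  "(norm (prox \<gamma> g u - prox \<gamma> g v))\<^sup>2 \<le> inner (prox \<gamma> g u - prox \<gamma> g v) (u - v)"
proof -
  have "0 \<le> inner ((1/\<gamma>) *\<^sub>R (u - prox \<gamma> g u) - (1/\<gamma>) *\<^sub>R (v - prox \<gamma> g v)) (prox \<gamma> g u - prox \<gamma> g v)"
    by (rule subdiff_monotone[OF prox_subdiff prox_subdiff])
  also have "\<dots> = inner ((u - v) - (prox \<gamma> g u - prox \<gamma> g v)) (prox \<gamma> g u - prox \<gamma> g v) / \<gamma>"
    by (simp add: inner_diff_left diff_divide_distrib)
  finally have "0 \<le> inner ((u - v) - (prox \<gamma> g u - prox \<gamma> g v)) (prox \<gamma> g u - prox \<gamma> g v)"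
    using gamma_pos by (simp add: zero_le_divide_iff)
  then show ?thesis
    by (simp add: power2_norm_eq_inner inner_diff_left[of "u - v"] inner_commute[of _ "u - v"])
qed

lemma prox_nonexpansive: "norm (prox \<gamma> g u - prox \<gamma> g v) \<le> norm (u - v)"
proof -
  have "norm (prox \<gamma> g u - prox \<gamma> g v) * norm (prox \<gamma> g u - prox \<gamma> g v)
      \<le> norm (prox \<gamma> g u - prox \<gamma> g v) * norm (u - v)"
    using prox_firmly_nonexpansive[of u v] norm_cauchy_schwarz[of "prox \<gamma> g u - prox \<gamma> g v" "u - v"]
    by (simp add: power2_eq_square)
  then show ?thesis by (cases "prox \<gamma> g u = prox \<gamma> g v") auto
qed

text \<open>Monotonicity against the residual at the proximal point leaves a negative multiple of
  the squared distance. Thus \<open>prox\<close> inverts the identity plus \<open>\<gamma>\<close>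
  times the subdifferential.\<close>

lemma subdiff_imp_prox:
  assumes "y \<in> subdiff g x" shows "prox \<gamma> g (x + \<gamma> *\<^sub>R y) = x"
proof -
  define p where "p = prox \<gamma> g (x + \<gamma> *\<^sub>R y)"
  have "0 \<le> inner (y - (1/\<gamma>) *\<^sub>R (x + \<gamma> *\<^sub>R y - p)) (x - p)"
    unfolding p_def by (rule subdiff_monotone[OF prox_subdiff assms])
  also have "y - (1/\<gamma>) *\<^sub>R (x + \<gamma> *\<^sub>R y - p) = - (1/\<gamma>) *\<^sub>R (x - p)"
    using gamma_pos by (simp add: algebra_simps)
  finally have "(norm (x - p))\<^sup>2 \<le> 0"
    using gamma_pos by (simp add: power2_norm_eq_inner divide_le_0_iff)
  then show ?thesis by (simp add: p_def)
qed

text \<open>Minty parametrization; the parameter of a graph point is recovered as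
  \<open>x + \<gamma> *\<^sub>R y\<close>.\<close>

lemma gph_subdiff_eq: "gph (subdiff g) = range (\<lambda>u. (prox \<gamma> g u, (1/\<gamma>) *\<^sub>R (u - prox \<gamma> g u)))"
proof -
  have "(x, y) \<in> range (\<lambda>u. (prox \<gamma> g u, (1/\<gamma>) *\<^sub>R (u - prox \<gamma> g u)))" if "y \<in> subdiff g x" for x y
    using subdiff_imp_prox[OF that] gamma_pos by (intro range_eqI[of _ _ "x + \<gamma> *\<^sub>R y"]) simp
  then show ?thesis using prox_subdiff by (auto simp: gph_def)
qed

section \<open>The Moreau envelope and its gradient\<close>

lemma moreau_env_eq:
  "moreau_env \<gamma> g u = g (prox \<gamma> g u) + ereal ((norm (prox \<gamma> g u - u))\<^sup>2 / (2 * \<gamma>))"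
  unfolding moreau_env_def
  using prox_mem[of u] by (intro antisym INF_lower INF_greatest) (auto simp: prox_set_def)

lemma g_prox_finite: "\<bar>g (prox \<gamma> g u)\<bar> \<noteq> \<infinity>"
  using prox_subdiff[of u] by (auto simp: subdiff_def)

text \<open>The lower bound is the subgradient inequality at \<open>prox \<gamma> g u\<close> with a
  square dropped; the upper one tests the proximal problem of \<open>v\<close> with
  \<open>prox \<gamma> g u\<close>. Together they make \<open>u - prox \<gamma> g u\<close> the
  gradient.\<close>

lemma moreau_env_bounds:
  fixes u v
  defines "e \<equiv> \<lambda>u. \<gamma> * real_of_ereal (moreau_env \<gamma> g u)"
  shows "e u + inner (u - prox \<gamma> g u) (v - u) \<le> e v"
    and "e v \<le> e u + inner (u - prox \<gamma> g u) (v - u) + (norm (v - u))\<^sup>2 / 2"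
proof -
  define G where "G u = real_of_ereal (g (prox \<gamma> g u))" for u
  have G: "g (prox \<gamma> g u) = ereal (G u)" for u
    using g_prox_finite[of u] by (simp add: G_def ereal_real)
  have e: "e u = \<gamma> * G u + (norm (prox \<gamma> g u - u))\<^sup>2 / 2" for u
    using gamma_pos by (simp add: e_def moreau_env_eq G distrib_left)
  define a b where "a = u - prox \<gamma> g u" and "b = v - prox \<gamma> g v"
  have "ereal (G u + inner ((1/\<gamma>) *\<^sub>R a) (prox \<gamma> g v - prox \<gamma> g u)) \<le> ereal (G v)"
    unfolding G[symmetric] plus_ereal.simps(1)[symmetric] a_def
    using prox_subdiff[of u] by (simp add: subdiff_def)
  then have "\<gamma> * G u + inner a (prox \<gamma> g v - prox \<gamma> g u) \<le> \<gamma> * G v"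
    using gamma_pos by (simp add: field_simps)
  moreover have "prox \<gamma> g v - prox \<gamma> g u = (v - u) - (b - a)" by (simp add: a_def b_def)
  moreover have "(norm b)\<^sup>2 = (norm a)\<^sup>2 + 2 * inner a (b - a) + (norm (b - a))\<^sup>2"
    using norm_diff_square_expand[of b 0 a] by simp
  ultimately have "\<gamma> * G u + (norm a)\<^sup>2 / 2 + inner a (v - u) + (norm (b - a))\<^sup>2 / 2 \<le> \<gamma> * G v + (norm b)\<^sup>2 / 2"
    by (simp only: inner_diff_right[of a "v - u" "b - a"]) argo
  then have "\<gamma> * G u + (norm a)\<^sup>2 / 2 + inner a (v - u) \<le> \<gamma> * G v + (norm b)\<^sup>2 / 2"
    using zero_le_power2[of "norm (b - a)"] by linarith
  then show "e u + inner (u - prox \<gamma> g u) (v - u) \<le> e v"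
    by (simp add: e a_def b_def norm_minus_commute)
  have "g (prox \<gamma> g v) + ereal ((norm (prox \<gamma> g v - v))\<^sup>2 / (2 * \<gamma>))
      \<le> g (prox \<gamma> g u) + ereal ((norm (prox \<gamma> g u - v))\<^sup>2 / (2 * \<gamma>))"
    using prox_mem[of v] by (simp add: prox_set_def)
  then have "\<gamma> * (G v + (norm (prox \<gamma> g v - v))\<^sup>2 / (2 * \<gamma>)) \<le> \<gamma> * (G u + (norm (prox \<gamma> g u - v))\<^sup>2 / (2 * \<gamma>))"
    using gamma_pos by (simp add: G)
  then have "\<gamma> * G v + (norm (prox \<gamma> g v - v))\<^sup>2 / 2 \<le> \<gamma> * G u + (norm (prox \<gamma> g u - v))\<^sup>2 / 2"
    using gamma_pos by (simp add: distrib_left)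
  moreover have "(norm (v - prox \<gamma> g u))\<^sup>2 = (norm (u - prox \<gamma> g u))\<^sup>2 + 2 * inner (u - prox \<gamma> g u) (v - u) + (norm (v - u))\<^sup>2"
    by (rule norm_diff_square_expand)
  ultimately show "e v \<le> e u + inner (u - prox \<gamma> g u) (v - u) + (norm (v - u))\<^sup>2 / 2"
    by (simp add: e norm_minus_commute add_divide_distrib)
qed

end

section \<open>The quadratic composite problem\<close>

lemma reg_coderiv_scaleR:
  assumes "z \<in> reg_coderiv F u d" "c > 0"
  shows "c *\<^sub>R z \<in> reg_coderiv F u (c *\<^sub>R d)"
  unfolding reg_coderiv_def
proof (intro CollectI allI impI)
  fix \<epsilon> :: real assume "\<epsilon> > 0"
  then have "\<epsilon> / c > 0" using assms(2) by simp
  then obtain \<delta> where \<delta>: "\<delta> > 0" "\<And>u'. norm (u' - u) < \<delta> \<Longrightarrow>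
      inner z (u' - u) - inner d (F u' - F u) \<le> \<epsilon> / c * norm (u' - u)"
    using assms(1) unfolding reg_coderiv_def by blast
  show "\<exists>\<delta>>0. \<forall>u'. norm (u' - u) < \<delta> \<longrightarrow>
      inner (c *\<^sub>R z) (u' - u) - inner (c *\<^sub>R d) (F u' - F u) \<le> \<epsilon> * norm (u' - u)"
  proof (intro exI[of _ \<delta>] conjI allI impI \<delta>(1))
    fix u' assume "norm (u' - u) < \<delta>"
    from mult_left_mono[OF \<delta>(2)[OF this], of c] assms(2)
    show "inner (c *\<^sub>R z) (u' - u) - inner (c *\<^sub>R d) (F u' - F u) \<le> \<epsilon> * norm (u' - u)"
      by (simp add: right_diff_distrib)
  qed
qed

lemma sym_mat_inner: "sym_mat A \<Longrightarrow> inner (A *v x) y = inner x (A *v y)"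
  unfolding sym_mat_def by (metis dot_lmul_matrix vector_transpose_matrix)

text \<open>\<open>m\<close> is the minimum of the quadratic form on the unit sphere; homogeneity
  extends the bound.\<close>

lemma pos_def_lower_bound:
  fixes A :: "real^'n^'n"
  assumes "pos_def A"
  obtains m where "m > 0" "\<And>x. m * (norm x)\<^sup>2 \<le> inner x (A *v x)"
proof -
  have "continuous_on (sphere 0 1) (\<lambda>x. inner x (A *v x))"
    by (intro continuous_intros linear_continuous_on) auto
  moreover have "sphere (0::real^'n) 1 \<noteq> {}" using vector_choose_size[of 1] by force
  ultimately obtain x0 where x0: "x0 \<in> sphere 0 1" "\<And>x. x \<in> sphere 0 1 \<Longrightarrow> inner x0 (A *v x0) \<le> inner x (A *v x)"
    using continuous_attains_inf[OF compact_sphere] by blast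
  have "x0 \<noteq> 0" using x0(1) by auto
  then have "0 < inner x0 (A *v x0)" using assms by (simp add: pos_def_def)
  moreover have "inner x0 (A *v x0) * (norm x)\<^sup>2 \<le> inner x (A *v x)" for x
  proof (cases "x = 0")
    case False
    define y where "y = x /\<^sub>R norm x"
    have x: "x = norm x *\<^sub>R y" using False by (simp add: y_def)
    have "inner x0 (A *v x0) \<le> inner y (A *v y)" using False by (intro x0) (simp add: y_def)
    then have "inner x0 (A *v x0) * (norm x)\<^sup>2 \<le> inner y (A *v y) * (norm x)\<^sup>2" by (intro mult_right_mono) auto
    also have "\<dots> = inner x (A *v x)"
      using arg_cong[OF x, of "\<lambda>x. inner x (A *v x)"]
      by (simp add: matrix_vector_mult_scaleR power2_eq_square)
    finally show ?thesis .
  qed simp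
  ultimately show thesis using that by blast
qed

section \<open>The matrices \<open>Q\<close> and \<open>P\<close> and the function psi\<close>

locale gdna_setting = prox_setting g \<gamma> for g :: "real^'n \<Rightarrow> ereal" and \<gamma> :: real +
  fixes A :: "real^'n^'n"
  assumes A_sym: "sym_mat A" and A_pd: "pos_def A" and S_pd: "pos_def (mat 1 - \<gamma> *\<^sub>R A)"
begin

abbreviation "Q \<equiv> gdna_Q A \<gamma>"
abbreviation "P \<equiv> gdna_P A \<gamma>"
abbreviation "T \<equiv> prox \<gamma> g"
abbreviation "\<psi> b \<equiv> gdna_psi A b g \<gamma>"
abbreviation "\<Psi> b \<equiv> gdna_grad A b g \<gamma>"

lemma S_apply: "(mat 1 - \<gamma> *\<^sub>R A) *v x = x - \<gamma> *\<^sub>R (A *v x)"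
  by (simp add: matrix_vector_mult_diff_rdistrib flip: scaleR_matrix_vector_assoc)

lemma Q_inverse:
  "Q *v (x - \<gamma> *\<^sub>R (A *v x)) = x" "(Q *v x) - \<gamma> *\<^sub>R (A *v (Q *v x)) = x"
proof -
  have "\<forall>x. (mat 1 - \<gamma> *\<^sub>R A) *v x = 0 \<longrightarrow> x = 0"
    using S_pd unfolding pos_def_def by (metis inner_zero_right less_irrefl)
  then have "invertible (mat 1 - \<gamma> *\<^sub>R A)"
    by (simp add: invertible_left_inverse matrix_left_invertible_ker)
  then have "(mat 1 - \<gamma> *\<^sub>R A) ** Q = mat 1 \<and> Q ** (mat 1 - \<gamma> *\<^sub>R A) = mat 1"
    unfolding invertible_def gdna_Q_def matrix_inv_def by (rule someI_ex)
  then show "Q *v (x - \<gamma> *\<^sub>R (A *v x)) = x" "(Q *v x) - \<gamma> *\<^sub>R (A *v (Q *v x)) = x"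
    by (metis S_apply matrix_vector_mul_assoc matrix_vector_mul_lid)+
qed

lemma P_apply: "P *v x = Q *v x - x"
  by (simp add: gdna_P_def matrix_vector_mult_diff_rdistrib)

lemma Q_sym: "inner (Q *v x) y = inner x (Q *v y)"
proof -
  have "inner (Q *v x) y = inner (Q *v x) (Q *v y - \<gamma> *\<^sub>R (A *v (Q *v y)))" by (simp only: Q_inverse)
  also have "\<dots> = inner (Q *v x - \<gamma> *\<^sub>R (A *v (Q *v x))) (Q *v y)"
    by (simp add: inner_diff_left inner_diff_right sym_mat_inner[OF A_sym])
  also have "\<dots> = inner x (Q *v y)" by (simp only: Q_inverse)
  finally show ?thesis .
qed

text \<open>With \<open>a = \<gamma> A\<close> and \<open>x = (1 - a) y\<close> this is \<open>a (1 - a) = a (1 - a) a + (1 - a) a (1 - a)\<close>.\<close>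

lemma P_pos_def: "pos_def P"
  unfolding pos_def_def
proof (intro allI impI)
  fix x :: "real^'n" assume x: "x \<noteq> 0"
  define y where "y = Q *v x"
  define a where "a = \<gamma> *\<^sub>R (A *v y)"
  have xy: "x = y - a" using Q_inverse(2)[of x] by (simp add: y_def a_def)
  have y: "y \<noteq> 0" using x xy by (auto simp: a_def)
  have "0 < inner y (A *v y)" using y A_pd by (simp add: pos_def_def)
  then have "a \<noteq> 0" using gamma_pos by (auto simp: a_def)
  then have "0 < inner a ((mat 1 - \<gamma> *\<^sub>R A) *v a)" using S_pd by (simp add: pos_def_def)
  then have 1: "0 < inner a a - \<gamma> * inner a (A *v a)" by (simp add: S_apply inner_diff_right)
  have 2: "0 < \<gamma> * inner x (A *v x)" using x A_pd gamma_pos by (simp add: pos_def_def)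
  have "\<gamma> * inner (A *v y) a = inner a a"
    by (subst (2) a_def) simp
  then have ya: "\<gamma> * inner y (A *v a) = inner a a" by (simp only: sym_mat_inner[OF A_sym])
  have "\<gamma> * inner x (A *v x) = inner (y - a) (\<gamma> *\<^sub>R (A *v (y - a)))" by (simp add: xy)
  also have "\<gamma> *\<^sub>R (A *v (y - a)) = a - \<gamma> *\<^sub>R (A *v a)"
    by (simp add: a_def matrix_vector_mult_diff_distrib scaleR_diff_right)
  also have "inner (y - a) (a - \<gamma> *\<^sub>R (A *v a)) = inner y a - inner a a - inner a a + \<gamma> * inner a (A *v a)"
    using ya by (simp add: inner_diff_left inner_diff_right right_diff_distrib)
  finally have "0 < inner y a - inner a a" using 1 2 by linarith
  also have "\<dots> = inner x (P *v x)"
  proof -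
    have "P *v x = a" using Q_inverse(2)[of x] by (simp add: P_apply y_def a_def algebra_simps)
    then show ?thesis by (simp add: xy inner_diff_left)
  qed
  finally show "0 < inner x (P *v x)" .
qed

lemma grad_diff: "\<Psi> b u - \<Psi> b v = Q *v (u - v) - (T u - T v)"
  by (simp add: gdna_grad_def matrix_vector_mult_diff_distrib)

text \<open>The quadratic part expands exactly with Hessian \<open>P\<close>, and the envelope adds
  a remainder between \<open>0\<close> and half the squared distance; \<open>P\<close> plus the
  identity is \<open>Q\<close>.\<close>

lemma psi_bounds:
  "\<psi> b u + inner (\<Psi> b u) (v - u) + 1/2 * inner (v - u) (P *v (v - u)) \<le> \<psi> b v"
  "\<psi> b v \<le> \<psi> b u + inner (\<Psi> b u) (v - u) + 1/2 * inner (v - u) (Q *v (v - u))"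
proof -
  define h where "h = v - u"
  have v: "v = u + h" by (simp add: h_def)
  have PS: "inner (P *v x) y = inner x (P *v y)" for x y
    by (simp add: P_apply Q_sym inner_diff_left inner_diff_right)
  have "inner (P *v h) u = inner (P *v u) h" by (metis PS inner_commute)
  then have quad: "1/2 * inner (P *v v) v = 1/2 * inner (P *v u) u + inner (P *v u) h + 1/2 * inner h (P *v h)"
    unfolding v by (simp add: matrix_vector_right_distrib inner_add_left inner_add_right inner_commute)
  have grad: "inner (\<Psi> b u) h = inner (P *v u) h + inner (gdna_c A b \<gamma>) h + inner (u - T u) h"
    by (simp add: gdna_grad_def P_apply inner_add_left inner_diff_left)
  have c: "inner (gdna_c A b \<gamma>) v = inner (gdna_c A b \<gamma>) u + inner (gdna_c A b \<gamma>) h"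
    by (simp add: v inner_add_right)
  have Q: "1/2 * inner h (Q *v h) = 1/2 * inner h (P *v h) + (norm h)\<^sup>2 / 2"
    by (simp add: P_apply inner_diff_right power2_norm_eq_inner field_simps)
  show "\<psi> b u + inner (\<Psi> b u) (v - u) + 1/2 * inner (v - u) (P *v (v - u)) \<le> \<psi> b v"
    using moreau_env_bounds(1)[of u v] quad grad c unfolding gdna_psi_def h_def[symmetric] by linarith
  show "\<psi> b v \<le> \<psi> b u + inner (\<Psi> b u) (v - u) + 1/2 * inner (v - u) (Q *v (v - u))"
    using moreau_env_bounds(2)[of v u] quad grad c Q unfolding gdna_psi_def h_def[symmetric] by linarith
qed

text \<open>\<open>b\<close> enters psi only through a linear term, so the constants serve all
  \<open>b\<close>. In \<open>K + 1\<close>, the bound of \<open>Q\<close> contributes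
  \<open>K\<close> and the nonexpansive proximal map \<open>1\<close>.\<close>

lemma ex_strongly_convex_C11: "\<exists>\<mu> L. \<forall>b. strongly_convex_C11 (\<psi> b) (\<Psi> b) \<mu> L"
proof -
  obtain \<mu> where \<mu>: "\<mu> > 0" "\<And>x. \<mu> * (norm x)\<^sup>2 \<le> inner x (P *v x)"
    using pos_def_lower_bound[OF P_pos_def] by blast
  obtain K where K: "K > 0" "\<And>x. norm (Q *v x) \<le> norm x * K"
    using bounded_linear.pos_bounded[OF matrix_vector_mul_bounded_linear[of Q]] by blast
  have "strongly_convex_C11 (\<psi> b) (\<Psi> b) \<mu> (K + 1)" for b
  proof
    show "\<mu> > 0" "K + 1 > 0" using \<mu> K by auto
    fix u v
    show "\<psi> b u + inner (\<Psi> b u) (v - u) + \<mu> / 2 * (norm (v - u))\<^sup>2 \<le> \<psi> b v"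
      using psi_bounds(1)[of b u v] \<mu>(2)[of "v - u"] by simp
    have "inner (v - u) (Q *v (v - u)) \<le> norm (v - u) * norm (Q *v (v - u))" by (rule norm_cauchy_schwarz)
    also have "\<dots> \<le> norm (v - u) * (norm (v - u) * K)" by (intro mult_left_mono K) auto
    also have "\<dots> \<le> (K + 1) * (norm (v - u))\<^sup>2" by (simp add: power2_eq_square algebra_simps)
    finally show "\<psi> b v \<le> \<psi> b u + inner (\<Psi> b u) (v - u) + (K + 1) / 2 * (norm (v - u))\<^sup>2"
      using psi_bounds(2)[of b v u] by simp
    have "norm (\<Psi> b u - \<Psi> b v) \<le> norm (Q *v (u - v)) + norm (T u - T v)"
      unfolding grad_diff by (rule norm_triangle_ineq4)
    then show "norm (\<Psi> b u - \<Psi> b v) \<le> (K + 1) * norm (u - v)"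
      using K(2)[of "u - v"] prox_nonexpansive[of u v] by (simp add: algebra_simps)
  qed
  then show ?thesis by blast
qed

section \<open>Optimality, uniqueness and tilt stability\<close>

lemma grad_zero_imp_subdiff:
  assumes "\<Psi> b u = 0"
  defines "x \<equiv> Q *v u + gdna_c A b \<gamma>"
  shows "T u = x" "(1/\<gamma>) *\<^sub>R (u - x) = - (A *v x) - b" "- (A *v x) - b \<in> subdiff g x"
proof -
  show 1: "T u = x" using assms(1) by (simp add: x_def gdna_grad_def algebra_simps)
  \<comment> \<open>Undoing \<open>Q\<close> here expresses \<open>u - x\<close> through the
    gradient of the smooth part of the objective.\<close>
  have "x = Q *v (u + \<gamma> *\<^sub>R b)"
    by (simp add: x_def gdna_c_def matrix_vector_right_distrib matrix_vector_mult_scaleR)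
  then have "x - \<gamma> *\<^sub>R (A *v x) = u + \<gamma> *\<^sub>R b" by (simp only: Q_inverse)
  then have "u - x = \<gamma> *\<^sub>R (- (A *v x) - b)" by (simp add: algebra_simps)
  then show 2: "(1/\<gamma>) *\<^sub>R (u - x) = - (A *v x) - b" using gamma_pos by simp
  show "- (A *v x) - b \<in> subdiff g x" using prox_subdiff[of u] by (simp only: 1 2)
qed

text \<open>A zero of the gradient of psi solves the optimality condition for every linear term; the
  tilted problems use this with \<open>b - v\<close>.\<close>

lemma ex_subdiff_solution: "\<exists>x. - (A *v x) - b \<in> subdiff g x"
proof -
  obtain \<mu> L where "strongly_convex_C11 (\<psi> b) (\<Psi> b) \<mu> L" using ex_strongly_convex_C11 by blast
  then obtain u where "\<Psi> b u = 0" using strongly_convex_C11.ex_zero_grad by blast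
  then show ?thesis using grad_zero_imp_subdiff(3) by blast
qed

text \<open>Monotonicity of the subdifferential eliminates \<open>g\<close>, and the form of
  \<open>A\<close> controls the distance. Tilts thereby get the Lipschitz constant
  \<open>1 / m\<close>.\<close>

lemma subdiff_solution_lipschitz:
  assumes m: "m > 0" "\<And>x. m * (norm x)\<^sup>2 \<le> inner x (A *v x)"
    and x: "- (A *v x) - b \<in> subdiff g x" and x': "- (A *v x') - b' \<in> subdiff g x'"
  shows "norm (x - x') \<le> norm (b - b') / m"
proof -
  have "0 \<le> inner ((- (A *v x) - b) - (- (A *v x') - b')) (x - x')" by (rule subdiff_monotone[OF x' x])
  also have "\<dots> = - inner (x - x') (A *v (x - x')) - inner (b - b') (x - x')"
    by (simp add: matrix_vector_mult_diff_distrib inner_diff_left inner_diff_right inner_commute)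
  finally have "m * (norm (x - x'))\<^sup>2 \<le> - inner (b - b') (x - x')" using m(2)[of "x - x'"] by linarith
  also have "\<dots> \<le> norm (b - b') * norm (x - x')" using Cauchy_Schwarz_ineq2[of "b - b'" "x - x'"] by linarith
  finally have "(m * norm (x - x')) * norm (x - x') \<le> norm (b - b') * norm (x - x')"
    by (simp add: power2_eq_square)
  then have "m * norm (x - x') \<le> norm (b - b')" by (cases "x = x'") auto
  then show ?thesis using m by (simp add: field_simps)
qed

text \<open>The linear term of the exact quadratic expansion cancels against the subgradient
  inequality; half the form of \<open>A\<close> at \<open>y - x\<close> remains and forces
  uniqueness.\<close>

lemma subdiff_solution_minimizes:
  assumes x: "- (A *v x) - b \<in> subdiff g x"
  shows "ereal (1/2 * inner (A *v x) x + inner b x) + g x \<le> ereal (1/2 * inner (A *v y) y + inner b y) + g y"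
    and "ereal (1/2 * inner (A *v y) y + inner b y) + g y \<le> ereal (1/2 * inner (A *v x) x + inner b x) + g x \<Longrightarrow> y = x"
proof -
  define h where "h = y - x"
  have y: "y = x + h" by (simp add: h_def)
  obtain r where r: "g x = ereal r" using x by (auto simp: subdiff_def)
  have sub: "ereal (r + inner (- (A *v x) - b) h) \<le> g y"
    using x unfolding subdiff_def h_def by (simp add: r)
  have "inner (A *v h) x = inner (A *v x) h" by (metis sym_mat_inner[OF A_sym] inner_commute)
  then have q: "1/2 * inner (A *v y) y + inner b y + (r + inner (- (A *v x) - b) h)
      = 1/2 * inner (A *v x) x + inner b x + r + 1/2 * inner h (A *v h)"
    unfolding y by (simp add: matrix_vector_right_distrib inner_add_left inner_add_right inner_diff_left
        inner_commute[of _ "A *v _"] inner_commute[of h b] add_divide_distrib)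
  have pos: "0 < inner h (A *v h)" if "h \<noteq> 0" using that A_pd by (simp add: pos_def_def)
  then have nn: "0 \<le> inner h (A *v h)" by (cases "h = 0") auto
  have low: "ereal (1/2 * inner (A *v x) x + inner b x + r + 1/2 * inner h (A *v h))
      \<le> ereal (1/2 * inner (A *v y) y + inner b y) + g y"
    unfolding q[symmetric] plus_ereal.simps(1)[symmetric, of "1/2 * inner (A *v y) y + inner b y"]
    by (intro add_left_mono sub)
  show "ereal (1/2 * inner (A *v x) x + inner b x) + g x \<le> ereal (1/2 * inner (A *v y) y + inner b y) + g y"
    by (rule order_trans[OF _ low]) (use nn in \<open>simp add: r\<close>)
  show "y = x" if "ereal (1/2 * inner (A *v y) y + inner b y) + g y \<le> ereal (1/2 * inner (A *v x) x + inner b x) + g x"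
    using order_trans[OF low that] pos by (cases "h = 0") (auto simp: r h_def)
qed

text \<open>Tilting by \<open>v\<close> replaces \<open>b\<close> by \<open>b - v\<close>, so
  solutions \<open>M v\<close> of the shifted optimality conditions are the global minimizers of the
  tilted functions.\<close>

lemma tilt_stable:
  assumes phi: "\<And>x. \<phi> x = ereal (1/2 * inner (A *v x) x + inner b x + \<alpha>) + g x"
    and xb: "- (A *v xb) - b \<in> subdiff g xb"
  shows "tilt_stable_min \<phi> xb" and "{x. \<forall>y. \<phi> x \<le> \<phi> y} = {xb}"
proof -
  obtain m where m: "m > 0" "\<And>x. m * (norm x)\<^sup>2 \<le> inner x (A *v x)"
    using pos_def_lower_bound[OF A_pd] by blast
  obtain M where M: "\<And>v. - (A *v M v) - (b - v) \<in> subdiff g (M v)"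
    using choice[OF allI[OF ex_subdiff_solution], of "\<lambda>v. b - v"] by blast
  have lip: "norm (M v - M w) \<le> norm (v - w) / m" for v w
    using subdiff_solution_lipschitz[OF m M M, of v w] by (simp add: norm_minus_commute)
  have M0: "M 0 = xb" using subdiff_solution_lipschitz[OF m M[of 0] xb] by simp
  have shift: "\<phi> x - ereal (inner v x) = ereal \<alpha> + (ereal (1/2 * inner (A *v x) x + inner (b - v) x) + g x)" for x v
    by (cases "g x") (simp_all add: phi inner_diff_left)
  have min: "\<phi> (M v) - ereal (inner v (M v)) \<le> \<phi> y - ereal (inner v y)" for v y
    unfolding shift by (intro add_left_mono subdiff_solution_minimizes(1) M)
  have uniq: "y = M v" if "\<phi> y - ereal (inner v y) \<le> \<phi> (M v) - ereal (inner v (M v))" for v y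
    using that unfolding shift by (intro subdiff_solution_minimizes(2)[OF M]) (simp add: ereal_add_le_add_iff)
  show "{x. \<forall>y. \<phi> x \<le> \<phi> y} = {xb}"
    using min[of 0] uniq[of _ 0] by (auto simp: M0)
  show "tilt_stable_min \<phi> xb"
    unfolding tilt_stable_min_def
  \<comment> \<open>Tilts shorter than \<open>m\<close> move \<open>M v\<close> by at most
    \<open>1\<close>, so minimizing over the unit ball about \<open>xb\<close> agrees with
    minimizing globally.\<close>
  proof (rule exI[of _ 1], rule conjI[OF zero_less_one], rule exI[of _ m], rule conjI[OF m(1)],
      rule exI[of _ "1 / m"], rule exI[of _ M], intro conjI ballI)
    show "M 0 = xb" by (rule M0)
    show "(1 / m)-lipschitz_on (ball 0 m) M"
      using lip m by (auto simp: lipschitz_on_def dist_norm)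
    fix v :: "real^'n" assume v: "v \<in> ball 0 m"
    have "norm (M v - xb) \<le> norm v / m" using lip[of v 0] by (simp add: M0)
    also have "\<dots> \<le> 1" using v m by (simp add: field_simps)
    finally have "M v \<in> cball xb 1" by (simp add: dist_norm norm_minus_commute)
    then show "{x \<in> cball xb 1. \<forall>y\<in>cball xb 1. \<phi> x - ereal (inner v x) \<le> \<phi> y - ereal (inner v y)} = {M v}"
      using min[of v] uniq[of _ v] by blast
  qed
qed

section \<open>Normals to the graph of the subdifferential as coderivative values\<close>

text \<open>In the Minty parametrization the pairing with this normal is the expression defining the
  coderivative, divided by \<open>\<gamma>\<close>. The parametrization is bi-Lipschitz, so
  neighbourhoods and error terms match.\<close>

lemma reg_normal_gph_subdiff_iff:
  "((1/\<gamma>) *\<^sub>R (d - w), - w) \<in> reg_normal (gph (subdiff g)) (T u, (1/\<gamma>) *\<^sub>R (u - T u))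
    \<longleftrightarrow> Q *v d - w \<in> reg_coderiv (\<Psi> b) u d"
proof -
  define X where "X u = (T u, (1/\<gamma>) *\<^sub>R (u - T u))" for u
  define J where "J u' = inner (Q *v d - w) (u' - u) - inner d (\<Psi> b u' - \<Psi> b u)" for u'
  have X_diff: "X u' - X u = (T u' - T u, (1/\<gamma>) *\<^sub>R ((u' - u) - (T u' - T u)))" for u'
    by (simp add: X_def scaleR_diff_right)
  have inner_eq: "inner ((1/\<gamma>) *\<^sub>R (d - w), - w) (X u' - X u) = J u' / \<gamma>" for u'
  proof -
    have "J u' = inner d (T u' - T u) - inner w (u' - u)"
      by (simp add: J_def grad_diff inner_diff_left[of "Q *v d"] inner_diff_right[of d "Q *v _"] Q_sym)
    moreover have "inner ((1/\<gamma>) *\<^sub>R (d - w), - w) (x, (1/\<gamma>) *\<^sub>R (h - x)) = (inner d x - inner w h) / \<gamma>" for x h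
      by (simp add: inner_diff_left inner_diff_right diff_divide_distrib)
    ultimately show ?thesis by (simp only: X_diff)
  qed
  define C where "C = 1 + 2 / \<gamma>"
  have C: "C > 0" using gamma_pos by (simp add: C_def add_pos_pos)
  have N1: "norm (X u' - X u) \<le> C * norm (u' - u)" for u'
  proof -
    have "norm (X u' - X u) \<le> norm (T u' - T u) + norm ((1/\<gamma>) *\<^sub>R ((u' - u) - (T u' - T u)))"
      unfolding X_diff by (rule norm_Pair_le)
    also have "norm ((1/\<gamma>) *\<^sub>R ((u' - u) - (T u' - T u))) \<le> (norm (u' - u) + norm (T u' - T u)) / \<gamma>"
      using gamma_pos norm_triangle_ineq4[of "u' - u" "T u' - T u"] by (simp add: divide_right_mono)
    also have "\<dots> \<le> (norm (u' - u) + norm (u' - u)) / \<gamma>"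
      using gamma_pos prox_nonexpansive[of u' u] by (intro divide_right_mono) auto
    finally show ?thesis using prox_nonexpansive[of u' u] by (simp add: C_def algebra_simps)
  qed
  have N2: "norm (u' - u) \<le> (1 + \<gamma>) * norm (X u' - X u)" for u'
  proof -
    have "u' - u = fst (X u' - X u) + \<gamma> *\<^sub>R snd (X u' - X u)"
      using gamma_pos by (simp add: X_def scaleR_diff_right)
    then have "norm (u' - u) \<le> norm (fst (X u' - X u)) + \<gamma> * norm (snd (X u' - X u))"
      using gamma_pos norm_triangle_ineq[of "fst (X u' - X u)" "\<gamma> *\<^sub>R snd (X u' - X u)"] by simp
    also have "\<dots> \<le> norm (X u' - X u) + \<gamma> * norm (X u' - X u)"
      using gamma_pos norm_fst_le[of "fst (X u' - X u)" "snd (X u' - X u)"]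
        norm_snd_le[of "snd (X u' - X u)" "fst (X u' - X u)"]
      by (intro add_mono mult_left_mono) (simp_all only: prod.collapse less_imp_le)
    finally show ?thesis by (simp add: algebra_simps)
  qed
  have gph: "gph (subdiff g) = range X" unfolding X_def by (rule gph_subdiff_eq)
  have "((1/\<gamma>) *\<^sub>R (d - w), - w) \<in> reg_normal (gph (subdiff g)) (X u) \<longleftrightarrow>
      (\<forall>\<epsilon>>0. \<exists>\<delta>>0. \<forall>u'. norm (X u' - X u) < \<delta> \<longrightarrow> J u' / \<gamma> \<le> \<epsilon> * norm (X u' - X u))"
    unfolding reg_normal_def gph by (simp add: inner_eq)
  also have "\<dots> \<longleftrightarrow> (\<forall>\<epsilon>>0. \<exists>\<delta>>0. \<forall>u'. norm (u' - u) < \<delta> \<longrightarrow> J u' \<le> \<epsilon> * norm (u' - u))"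
  proof (intro iffI allI impI)
    fix \<epsilon> :: real assume "\<epsilon> > 0"
      and H: "\<forall>\<epsilon>>0. \<exists>\<delta>>0. \<forall>u'. norm (X u' - X u) < \<delta> \<longrightarrow> J u' / \<gamma> \<le> \<epsilon> * norm (X u' - X u)"
    then have "\<epsilon> / (\<gamma> * C) > 0" using gamma_pos C by simp
    then obtain \<delta> where \<delta>: "\<delta> > 0"
        "\<And>u'. norm (X u' - X u) < \<delta> \<Longrightarrow> J u' / \<gamma> \<le> \<epsilon> / (\<gamma> * C) * norm (X u' - X u)"
      using H by blast
    show "\<exists>\<delta>>0. \<forall>u'. norm (u' - u) < \<delta> \<longrightarrow> J u' \<le> \<epsilon> * norm (u' - u)"
    proof (rule exI[of _ "\<delta> / C"], intro conjI allI impI)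
      show "\<delta> / C > 0" using \<delta> C by simp
      fix u' assume "norm (u' - u) < \<delta> / C"
      then have "C * norm (u' - u) < \<delta>" using C by (simp add: field_simps)
      then have "J u' / \<gamma> \<le> \<epsilon> / (\<gamma> * C) * norm (X u' - X u)" using N1[of u'] by (intro \<delta>(2)) linarith
      also have "\<dots> \<le> \<epsilon> / (\<gamma> * C) * (C * norm (u' - u))"
        using \<open>\<epsilon> / (\<gamma> * C) > 0\<close> by (intro mult_left_mono N1) auto
      also have "\<dots> = \<epsilon> * norm (u' - u) / \<gamma>" using C by simp
      finally show "J u' \<le> \<epsilon> * norm (u' - u)" using gamma_pos by (simp add: divide_le_cancel)
    qed
  next
    fix \<epsilon> :: real assume "\<epsilon> > 0"
      and H: "\<forall>\<epsilon>>0. \<exists>\<delta>>0. \<forall>u'. norm (u' - u) < \<delta> \<longrightarrow> J u' \<le> \<epsilon> * norm (u' - u)"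
    then have e: "\<epsilon> * \<gamma> / (1 + \<gamma>) > 0" using gamma_pos by simp
    then obtain \<delta> where \<delta>: "\<delta> > 0" "\<And>u'. norm (u' - u) < \<delta> \<Longrightarrow> J u' \<le> \<epsilon> * \<gamma> / (1 + \<gamma>) * norm (u' - u)"
      using H by blast
    show "\<exists>\<delta>>0. \<forall>u'. norm (X u' - X u) < \<delta> \<longrightarrow> J u' / \<gamma> \<le> \<epsilon> * norm (X u' - X u)"
    proof (rule exI[of _ "\<delta> / (1 + \<gamma>)"], intro conjI allI impI)
      show "\<delta> / (1 + \<gamma>) > 0" using \<delta> gamma_pos by simp
      fix u' assume "norm (X u' - X u) < \<delta> / (1 + \<gamma>)"
      then have "(1 + \<gamma>) * norm (X u' - X u) < \<delta>" using gamma_pos by (simp add: pos_less_divide_eq mult.commute)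
      then have "J u' \<le> \<epsilon> * \<gamma> / (1 + \<gamma>) * norm (u' - u)" using N2[of u'] by (intro \<delta>(2)) linarith
      also have "\<dots> \<le> \<epsilon> * \<gamma> / (1 + \<gamma>) * ((1 + \<gamma>) * norm (X u' - X u))"
        using e by (intro mult_left_mono N2) auto
      also have "\<dots> = \<gamma> * (\<epsilon> * norm (X u' - X u))" using gamma_pos by simp
      finally show "J u' / \<gamma> \<le> \<epsilon> * norm (X u' - X u)" using gamma_pos by (simp add: pos_divide_le_eq mult.commute)
    qed
  qed
  also have "\<dots> \<longleftrightarrow> Q *v d - w \<in> reg_coderiv (\<Psi> b) u d"
    by (simp add: reg_coderiv_def J_def)
  finally show ?thesis by (simp only: X_def)
qed

text \<open>The regular equivalence passes to limits, since graph points and their parameters, and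
  normals and their pairs (\<open>d\<close>, \<open>w\<close>), determine each other
  continuously.\<close>

lemma lim_normal_gph_subdiff_iff:
  "((1/\<gamma>) *\<^sub>R (d - w), - w) \<in> lim_normal (gph (subdiff g)) (T u, (1/\<gamma>) *\<^sub>R (u - T u))
    \<longleftrightarrow> Q *v d - w \<in> lim_coderiv (\<Psi> b) u d"
proof
  have contQ: "(\<lambda>k. Q *v ds k) \<longlonglongrightarrow> Q *v d" if "ds \<longlonglongrightarrow> d" for ds d
    using that by (rule bounded_linear.tendsto[OF matrix_vector_mul_bounded_linear])
  {
    assume "((1/\<gamma>) *\<^sub>R (d - w), - w) \<in> lim_normal (gph (subdiff g)) (T u, (1/\<gamma>) *\<^sub>R (u - T u))"
    then obtain p n where p: "\<And>k. p k \<in> gph (subdiff g)" and n: "\<And>k. n k \<in> reg_normal (gph (subdiff g)) (p k)"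
      and lim: "p \<longlonglongrightarrow> (T u, (1/\<gamma>) *\<^sub>R (u - T u))" "n \<longlonglongrightarrow> ((1/\<gamma>) *\<^sub>R (d - w), - w)"
      unfolding lim_normal_def by blast
    have "\<forall>k. \<exists>u. p k = (T u, (1/\<gamma>) *\<^sub>R (u - T u))" using p unfolding gph_subdiff_eq by blast
    then obtain us where us: "\<And>k. p k = (T (us k), (1/\<gamma>) *\<^sub>R (us k - T (us k)))" by metis
    define ws where "ws k = - snd (n k)" for k
    define ds where "ds k = \<gamma> *\<^sub>R fst (n k) + ws k" for k
    have "n k = ((1/\<gamma>) *\<^sub>R (ds k - ws k), - ws k)" for k
      using gamma_pos by (simp add: ds_def ws_def prod_eq_iff)
    then have reg: "Q *v ds k - ws k \<in> reg_coderiv (\<Psi> b) (us k) (ds k)" for k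
      using n[of k] by (simp only: us reg_normal_gph_subdiff_iff[where b=b])
    have "us = (\<lambda>k. fst (p k) + \<gamma> *\<^sub>R snd (p k))" using gamma_pos by (simp add: us)
    moreover have "(\<lambda>k. fst (p k) + \<gamma> *\<^sub>R snd (p k)) \<longlonglongrightarrow> T u + \<gamma> *\<^sub>R ((1/\<gamma>) *\<^sub>R (u - T u))"
      using tendsto_fst[OF lim(1)] tendsto_snd[OF lim(1)] by (intro tendsto_intros) simp_all
    ultimately have lim_us: "us \<longlonglongrightarrow> u" using gamma_pos by simp
    have lim_ws: "ws \<longlonglongrightarrow> w"
      using tendsto_minus[OF tendsto_snd[OF lim(2)]] by (simp add: ws_def[abs_def])
    have "(\<lambda>k. \<gamma> *\<^sub>R fst (n k) + ws k) \<longlonglongrightarrow> \<gamma> *\<^sub>R ((1/\<gamma>) *\<^sub>R (d - w)) + w"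
      using tendsto_fst[OF lim(2)] lim_ws by (intro tendsto_intros) simp_all
    then have lim_ds: "ds \<longlonglongrightarrow> d" using gamma_pos by (simp add: ds_def[abs_def])
    show "Q *v d - w \<in> lim_coderiv (\<Psi> b) u d"
      unfolding lim_coderiv_def
      by (intro CollectI exI[of _ us] exI[of _ ds] exI[of _ "\<lambda>k. Q *v ds k - ws k"] conjI allI reg lim_us lim_ds
          tendsto_diff contQ lim_ws)
  }
  assume "Q *v d - w \<in> lim_coderiv (\<Psi> b) u d"
  then obtain us ds zs where reg: "\<And>k. zs k \<in> reg_coderiv (\<Psi> b) (us k) (ds k)"
    and lim: "us \<longlonglongrightarrow> u" "ds \<longlonglongrightarrow> d" "zs \<longlonglongrightarrow> Q *v d - w"
    unfolding lim_coderiv_def by blast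
  define ws where "ws k = Q *v ds k - zs k" for k
  have "(\<lambda>k. Q *v ds k - zs k) \<longlonglongrightarrow> Q *v d - (Q *v d - w)" by (intro tendsto_diff contQ lim)
  then have lim_ws: "ws \<longlonglongrightarrow> w" by (simp add: ws_def[abs_def])
  have n: "((1/\<gamma>) *\<^sub>R (ds k - ws k), - ws k) \<in> reg_normal (gph (subdiff g)) (T (us k), (1/\<gamma>) *\<^sub>R (us k - T (us k)))" for k
    unfolding reg_normal_gph_subdiff_iff[where b=b] using reg[of k] by (simp add: ws_def)
  have lim_T: "(\<lambda>k. T (us k)) \<longlonglongrightarrow> T u"
  proof (rule tendsto_norm_zero_cancel[THEN LIM_zero_cancel], rule Lim_null_comparison)
    show "\<forall>\<^sub>F k in sequentially. norm (norm (T (us k) - T u)) \<le> norm (us k - u)"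
      using prox_nonexpansive by simp
    show "(\<lambda>k. norm (us k - u)) \<longlonglongrightarrow> 0" using lim(1) by (intro tendsto_norm_zero) (simp add: LIM_zero_iff)
  qed
  show "((1/\<gamma>) *\<^sub>R (d - w), - w) \<in> lim_normal (gph (subdiff g)) (T u, (1/\<gamma>) *\<^sub>R (u - T u))"
    unfolding lim_normal_def
  proof (rule CollectI, rule exI[of _ "\<lambda>k. (T (us k), (1/\<gamma>) *\<^sub>R (us k - T (us k)))"],
      rule exI[of _ "\<lambda>k. ((1/\<gamma>) *\<^sub>R (ds k - ws k), - ws k)"], intro conjI allI n)
    show "(T (us k), (1/\<gamma>) *\<^sub>R (us k - T (us k))) \<in> gph (subdiff g)" for k
      unfolding gph_subdiff_eq by blast
  qed (intro tendsto_intros lim_T lim lim_ws)+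
qed

text \<open>In the algorithm \<open>w\<close> is \<open>Q *v d + \<Psi> b u\<close>, so
  \<open>Q *v d - w\<close> is minus the gradient and \<open>- \<Psi> b u - P *v d\<close> equals
  \<open>d - w\<close>.\<close>

lemma dir_ok_iff: "gdna_dir_ok A b g \<gamma> u d \<longleftrightarrow> - \<Psi> b u \<in> lim_coderiv (\<Psi> b) u d"
proof -
  have "- \<Psi> b u - P *v d = d - (Q *v d + \<Psi> b u)" by (simp add: P_apply)
  then show ?thesis
    using lim_normal_gph_subdiff_iff[of d "Q *v d + \<Psi> b u" u b]
    by (simp only: gdna_dir_ok_def Let_def subdiff2_def mem_Collect_eq) simp
qed

text \<open>A violating sequence is rescaled to unit directions and displacements. Limits of a
  subsequence form a directional normal to the graph, for which \<open>semismooth_star\<close>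
  contradicts the persistent gap \<open>\<epsilon>\<close>.\<close>

lemma semismooth_star_imp_semismooth_at:
  assumes semi: "semismooth_star (subdiff g) (T ub, (1/\<gamma>) *\<^sub>R (ub - T ub))"
  shows "semismooth_at (\<Psi> b) ub"
proof (rule ccontr)
  obtain \<mu> L where "strongly_convex_C11 (\<psi> b) (\<Psi> b) \<mu> L" using ex_strongly_convex_C11 by blast
  then interpret strongly_convex_C11 "\<psi> b" "\<Psi> b" \<mu> L .
  assume "\<not> semismooth_at (\<Psi> b) ub"
  then obtain \<epsilon> where eps: "\<epsilon> > 0" and "\<And>\<delta>. \<delta> > 0 \<Longrightarrow> \<exists>u d z. norm (u - ub) < \<delta> \<and> z \<in> reg_coderiv (\<Psi> b) u d \<and>
      \<epsilon> * norm (u - ub) * norm d < \<bar>inner z (u - ub) - inner d (\<Psi> b u - \<Psi> b ub)\<bar>"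
    unfolding semismooth_at_def by (auto simp: not_le)
  then have "\<exists>u d z. norm (u - ub) < 1 / real (Suc k) \<and> z \<in> reg_coderiv (\<Psi> b) u d \<and>
      \<epsilon> * norm (u - ub) * norm d < \<bar>inner z (u - ub) - inner d (\<Psi> b u - \<Psi> b ub)\<bar>" for k
    by simp
  then obtain us ds0 zs0 where us: "\<And>k. norm (us k - ub) < 1 / real (Suc k)"
    and reg0: "\<And>k. zs0 k \<in> reg_coderiv (\<Psi> b) (us k) (ds0 k)"
    and viol: "\<And>k. \<epsilon> * norm (us k - ub) * norm (ds0 k) <
      \<bar>inner (zs0 k) (us k - ub) - inner (ds0 k) (\<Psi> b (us k) - \<Psi> b ub)\<bar>"
    by metis
  define t where "t k = norm (us k - ub)" for k
  \<comment> \<open>At \<open>us k = ub\<close> both sides of the violation would vanish.\<close>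
  have t_pos: "t k > 0" for k using viol[of k] by (auto simp: t_def)
  \<comment> \<open>A zero direction admits only the zero coderivative value.\<close>
  have d_pos: "norm (ds0 k) > 0" for k
    using viol[of k] reg_coderiv_norm_le[OF reg0, of k] by auto
  define ds where "ds k = (1 / norm (ds0 k)) *\<^sub>R ds0 k" for k
  define zs where "zs k = (1 / norm (ds0 k)) *\<^sub>R zs0 k" for k
  define es where "es k = (1 / t k) *\<^sub>R (us k - ub)" for k
  define as where "as k = (1 / t k) *\<^sub>R (T (us k) - T ub)" for k
  have reg: "zs k \<in> reg_coderiv (\<Psi> b) (us k) (ds k)" for k
    unfolding zs_def ds_def using d_pos[of k] by (intro reg_coderiv_scaleR reg0) simp
  have bounds: "norm (ds k) \<le> 1" "norm (zs k) \<le> L" "norm (es k) \<le> 1" "norm (as k) \<le> 1" for k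
  proof -
    show d1: "norm (ds k) \<le> 1" using d_pos[of k] by (simp add: ds_def)
    then show "norm (zs k) \<le> L"
      using reg_coderiv_norm_le[OF reg[of k]] L_pos mult_left_mono[OF d1, of L] by linarith
    show "norm (es k) \<le> 1" using t_pos[of k] by (simp add: es_def t_def)
    show "norm (as k) \<le> 1" using t_pos[of k] prox_nonexpansive[of "us k" ub] by (simp add: as_def t_def)
  qed
  \<comment> \<open>The violation is homogeneous in displacement and direction, so division by
    \<open>t k * norm (ds0 k)\<close> leaves a fixed gap.\<close>
  have viol': "\<epsilon> \<le> \<bar>inner (zs k) (es k) - inner (ds k) (Q *v es k - as k)\<bar>" for k
  proof -
    define n where "n = norm (ds0 k)"
    have 1: "\<Psi> b (us k) - \<Psi> b ub = t k *\<^sub>R (Q *v es k - as k)" "us k - ub = t k *\<^sub>R es k"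
      using t_pos[of k] by (simp_all add: grad_diff es_def as_def scaleR_diff_right flip: matrix_vector_mult_scaleR)
    have 2: "zs0 k = n *\<^sub>R zs k" "ds0 k = n *\<^sub>R ds k"
      using d_pos[of k] by (simp_all add: zs_def ds_def n_def)
    have "inner (zs0 k) (us k - ub) - inner (ds0 k) (\<Psi> b (us k) - \<Psi> b ub)
        = (t k * n) * (inner (zs k) (es k) - inner (ds k) (Q *v es k - as k))"
      unfolding 1 2 by (simp add: right_diff_distrib)
    then have "inner (zs0 k) (us k - ub) - inner (ds0 k) (\<Psi> b (us k) - \<Psi> b ub)
        = (t k * norm (ds0 k)) * (inner (zs k) (es k) - inner (ds k) (Q *v es k - as k))"
      by (simp only: n_def)
    then have "\<epsilon> * (t k * norm (ds0 k)) < (t k * norm (ds0 k)) * \<bar>inner (zs k) (es k) - inner (ds k) (Q *v es k - as k)\<bar>"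
      using viol[of k] t_pos[of k] by (simp add: abs_mult t_def mult.assoc)
    then have "(t k * norm (ds0 k)) * \<epsilon> < (t k * norm (ds0 k)) * \<bar>inner (zs k) (es k) - inner (ds k) (Q *v es k - as k)\<bar>"
      by (simp only: mult.commute)
    moreover have "t k * norm (ds0 k) > 0" using t_pos[of k] d_pos[of k] by simp
    ultimately show ?thesis by (simp only: mult_less_cancel_left_pos less_imp_le)
  qed
  have "seq_compact (cball (0::real^'n) 1 \<times> cball (0::real^'n) L \<times> cball (0::real^'n) 1 \<times> cball (0::real^'n) 1)"
    by (intro compact_imp_seq_compact compact_Times compact_cball)
  moreover have "\<forall>k. (ds k, zs k, es k, as k) \<in> cball 0 1 \<times> cball 0 L \<times> cball 0 1 \<times> cball 0 1"
    using bounds by simp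
  ultimately obtain l r where r: "strict_mono (r :: nat \<Rightarrow> nat)"
      and lim: "((\<lambda>k. (ds k, zs k, es k, as k)) \<circ> r) \<longlonglongrightarrow> l"
    by (rule seq_compactE)
  obtain d z e a where l: "l = (d, z, e, a)" by (cases l)
  have lims: "(\<lambda>k. ds (r k)) \<longlonglongrightarrow> d" "(\<lambda>k. zs (r k)) \<longlonglongrightarrow> z" "(\<lambda>k. es (r k)) \<longlonglongrightarrow> e" "(\<lambda>k. as (r k)) \<longlonglongrightarrow> a"
    using tendsto_fst[OF lim] tendsto_fst[OF tendsto_snd[OF lim]]
      tendsto_fst[OF tendsto_snd[OF tendsto_snd[OF lim]]] tendsto_snd[OF tendsto_snd[OF tendsto_snd[OF lim]]]
    by (simp_all add: l o_def)
  have contQ: "(\<lambda>k. Q *v xs k) \<longlonglongrightarrow> Q *v x" if "xs \<longlonglongrightarrow> x" for xs x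
    using that by (rule bounded_linear.tendsto[OF matrix_vector_mul_bounded_linear])
  have "t \<longlonglongrightarrow> 0"
  proof (rule Lim_null_comparison)
    show "\<forall>\<^sub>F k in sequentially. norm (t k) \<le> 1 / real (Suc k)"
      using us by (intro always_eventually allI) (simp add: t_def less_imp_le)
    show "(\<lambda>k. 1 / real (Suc k)) \<longlonglongrightarrow> 0" by (rule LIMSEQ_Suc[OF lim_1_over_n])
  qed
  then have lim_t: "(\<lambda>k. t (r k)) \<longlonglongrightarrow> 0" using LIMSEQ_subseq_LIMSEQ[OF _ r] by (simp add: o_def)
  define w where "w = Q *v d - z"
  define ws where "ws k = Q *v ds k - zs k" for k
  have lim_ws: "(\<lambda>k. ws (r k)) \<longlonglongrightarrow> w" unfolding ws_def w_def by (intro tendsto_diff contQ lims)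
  \<comment> \<open>The graph point of \<open>us k\<close> is reached from that of \<open>ub\<close>
    by length \<open>t k\<close> along a direction converging on the subsequence, as
    \<open>dir_normal\<close> asks.\<close>
  have point: "(T ub, (1/\<gamma>) *\<^sub>R (ub - T ub)) + t k *\<^sub>R (as k, (1/\<gamma>) *\<^sub>R (es k - as k))
      = (T (us k), (1/\<gamma>) *\<^sub>R (us k - T (us k)))" for k
  proof -
    have "T ub + t k *\<^sub>R as k = T (us k)" using t_pos[of k] by (simp add: as_def)
    moreover have ts: "t k *\<^sub>R (es k - as k) = (us k - ub) - (T (us k) - T ub)"
      using t_pos[of k] by (simp add: es_def as_def scaleR_diff_right)
    have "(1/\<gamma>) *\<^sub>R (ub - T ub) + t k *\<^sub>R ((1/\<gamma>) *\<^sub>R (es k - as k)) = (1/\<gamma>) *\<^sub>R (us k - T (us k))"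
      unfolding scaleR_left_commute[of "t k" "1/\<gamma>"] ts scaleR_add_right[symmetric] by simp
    ultimately show ?thesis by simp
  qed
  have "((1/\<gamma>) *\<^sub>R (d - w), - w) \<in> dir_normal (gph (subdiff g)) (T ub, (1/\<gamma>) *\<^sub>R (ub - T ub)) (a, (1/\<gamma>) *\<^sub>R (e - a))"
    unfolding dir_normal_def
  proof (rule CollectI, rule exI[of _ "\<lambda>k. t (r k)"], rule exI[of _ "\<lambda>k. (as (r k), (1/\<gamma>) *\<^sub>R (es (r k) - as (r k)))"],
      rule exI[of _ "\<lambda>k. ((1/\<gamma>) *\<^sub>R (ds (r k) - ws (r k)), - ws (r k))"], intro conjI allI)
    show "t (r k) > 0" for k by (rule t_pos)
    show "((1/\<gamma>) *\<^sub>R (ds (r k) - ws (r k)), - ws (r k)) \<in> reg_normal (gph (subdiff g))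
        ((T ub, (1/\<gamma>) *\<^sub>R (ub - T ub)) + t (r k) *\<^sub>R (as (r k), (1/\<gamma>) *\<^sub>R (es (r k) - as (r k))))" for k
      unfolding point reg_normal_gph_subdiff_iff[where b=b] using reg[of "r k"] by (simp add: ws_def)
  qed (intro tendsto_intros lim_t lims lim_ws)+
  then have "inner ((1/\<gamma>) *\<^sub>R (d - w)) a = inner w ((1/\<gamma>) *\<^sub>R (e - a))"
    using semi unfolding semismooth_star_def dir_coderiv_def by blast
  then have "inner d a = inner w e" using gamma_pos by (simp add: inner_diff_left inner_diff_right)
  then have eq: "inner z e - inner d (Q *v e - a) = 0"
    by (simp add: w_def inner_diff_left inner_diff_right Q_sym)
  have "(\<lambda>k. \<bar>inner (zs (r k)) (es (r k)) - inner (ds (r k)) (Q *v es (r k) - as (r k))\<bar>) \<longlonglongrightarrow>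
      \<bar>inner z e - inner d (Q *v e - a)\<bar>"
    by (intro tendsto_rabs tendsto_diff tendsto_inner contQ lims)
  then have "\<epsilon> \<le> \<bar>inner z e - inner d (Q *v e - a)\<bar>"
    by (rule LIMSEQ_le_const) (use viol' in blast)
  then show False using eps eq by simp
qed

end

theorem theorem5p12:
  fixes A :: "real^'n^'n" and b :: "real^'n" and \<alpha> :: real
    and g :: "real^'n \<Rightarrow> ereal" and \<phi> :: "real^'n \<Rightarrow> ereal"
    and \<sigma> \<beta> \<gamma> :: real
  assumes A_sym: "sym_mat A" and A_pd: "pos_def A"
    and g_proper: "proper_fun g" and g_lsc: "lsc_fun g" and g_convex: "convex_fun g"
    and phi_def: "\<And>x. \<phi> x = ereal (1/2 * inner (A *v x) x + inner b x + \<alpha>) + g x"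
    and sigma: "0 < \<sigma>" "\<sigma> < 1/2" and beta: "0 < \<beta>" "\<beta> < 1"
    and gamma: "0 < \<gamma>" "pos_def (mat 1 - \<gamma> *\<^sub>R A)"
  shows "gdna_well_defined A b g \<gamma> \<sigma> \<beta> \<and>
    (\<forall>u::nat \<Rightarrow> real^'n. (\<forall>k. gdna_step A b g \<gamma> \<sigma> \<beta> (u k) (u (Suc k))) \<longrightarrow>
      (\<exists>ub. u \<longlonglongrightarrow> ub \<and> R_linear_conv u ub \<and>
         (let xb = gdna_Q A \<gamma> *v ub + gdna_c A b \<gamma>; vb = - (A *v xb) - b in
           tilt_stable_min \<phi> xb \<and> {x. \<forall>y. \<phi> x \<le> \<phi> y} = {xb} \<and>
           (semismooth_star (subdiff g) (xb, vb) \<and>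
             (\<sigma> < 1 / (2 * (1 + mat_norm (gdna_Q A \<gamma>)) * (1 / lambda_min (gdna_P A \<gamma>)))
              \<or> twice_epi_diff g xb vb)
            \<longrightarrow> Q_superlinear_conv u ub))))"
proof -
  interpret gdna_setting g \<gamma> A
    by unfold_locales (use assms in auto)
  obtain \<mu> L where "strongly_convex_C11 (\<psi> b) (\<Psi> b) \<mu> L" using ex_strongly_convex_C11 by blast
  then interpret strongly_convex_C11 "\<psi> b" "\<Psi> b" \<mu> L .
  have step: "gdna_step A b g \<gamma> \<sigma> \<beta> u u' \<longleftrightarrow> newton_step \<sigma> \<beta> u u'" for u u'
    by (simp add: gdna_step_def newton_step_def dir_ok_iff armijo_def)
  \<comment> \<open>Dependent choice; the invariant restricts only the term of index
    \<open>0\<close>, fixing the starting point.\<close>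
  have "\<exists>u. u 0 = u0 \<and> (\<forall>k. newton_step \<sigma> \<beta> (u k) (u (Suc k)))" for u0
    using dependent_nat_choice[of "\<lambda>k x. k = 0 \<longrightarrow> x = u0" "\<lambda>k. newton_step \<sigma> \<beta>"]
      ex_newton_step[OF sigma beta] by auto
  then have wd: "gdna_well_defined A b g \<gamma> \<sigma> \<beta>"
    unfolding gdna_well_defined_def step dir_ok_iff armijo_def
    using ex_lim_coderiv ex_armijo[OF sigma beta] by blast
  \<comment> \<open>Every run converges to this one zero of the gradient, whatever its starting
    point.\<close>
  obtain ub where zero: "\<Psi> b ub = 0" using ex_zero_grad by blast
  define xb where "xb = Q *v ub + gdna_c A b \<gamma>"
  note sol = grad_zero_imp_subdiff[OF zero, folded xb_def]
  have "Q_superlinear_conv u ub"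
    if "\<And>k. newton_step \<sigma> \<beta> (u k) (u (Suc k))" "u \<longlonglongrightarrow> ub" "semismooth_star (subdiff g) (xb, - (A *v xb) - b)" for u
    using that semismooth_star_imp_semismooth_at[of ub b] sol
    by (intro newton_Q_superlinear[OF sigma beta zero]) auto
  then have "\<exists>ub. u \<longlonglongrightarrow> ub \<and> R_linear_conv u ub \<and>
         (let xb = Q *v ub + gdna_c A b \<gamma>; vb = - (A *v xb) - b in
           tilt_stable_min \<phi> xb \<and> {x. \<forall>y. \<phi> x \<le> \<phi> y} = {xb} \<and>
           (semismooth_star (subdiff g) (xb, vb) \<and>
             (\<sigma> < 1 / (2 * (1 + mat_norm Q) * (1 / lambda_min P)) \<or> twice_epi_diff g xb vb)
            \<longrightarrow> Q_superlinear_conv u ub))"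
    if u: "\<And>k. newton_step \<sigma> \<beta> (u k) (u (Suc k))" for u
    unfolding Let_def
    using newton_R_linear[OF sigma beta zero, of u] R_linear_conv_imp_tendsto[of u ub]
      tilt_stable[OF phi_def sol(3)] u
    by (intro exI[of _ ub]) (auto simp: xb_def[symmetric])
  then show ?thesis using wd unfolding step by blast
qed

end
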